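(* Let $u_0\in H^{1/2}_+(\mathbb T)$ and let $u\in C(\mathbb R,H^{1/2}_+(\mathbb T))$ be the solution of the cubic Szeg\H{o} equation $$i\,\partial_t u=\Pi(|u|^2u)$$ with $u(0)=u_0$. Then for every $t\in\mathbb R$ and every $z\in D=\{z\in\mathbb C:|z|<1\}$, $$\underline u(t,z)=\Big(\big(I-z\,e^{-itH_{u_0}^2}e^{itK_{u_0}^2}S^*\big)^{-1}e^{-itH_{u_0}^2}u_0\,\Big|\,1\Big).$$
   Context: $\mathbb T=\mathbb R/2\pi\mathbb Z$ with normalized measure; $(f|g)=\frac1{2\pi}\int_0^{2\pi}f\bar g$ is the inner product on $L^2(\mathbb T)$, and $\hat f(k)=(f|e^{ikx})$. $L^2_+(\mathbb T)=\{u\in L^2:\hat u(k)=0\ \forall k<0\}$, $\Pi$ is the orthogonal (Szeg\H{o}) projector of $L^2$ onto $L^2_+$, and $H^s_+=H^s(\mathbb T)\cap L^2_+$. For $u\in L^2_+$, $\underline u(z)=\sum_{k\ge0}\hat u(k)z^k$, $z\in D$. The shift is $Su=e^{ix}u$ on $L^2_+$, with adjoint $S^*$. For $u\in H^{1/2}_+$, the Hankel operator $H_u$ is the antilinear operator $H_u(h)=\Pi(u\bar h)$ on $L^2_+$, and $K_u=H_uS=S^*H_u$; $H_u^2$ and $K_u^2$ are linear, positive, self-adjoint, trace class operators on $L^2_+$. The cubic Szeg\H{o} equation defines a continuous flow on $H^{1/2}_+$ (smooth on $H^s_+$, $s>1/2$); $u$ denotes the corresponding solution. *)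

theory Defs
  imports "HOL-Analysis.Analysis"
begin

text \<open>Elements of L2_+(T) are represented by their Fourier coefficient sequences
  (k \<ge> 0), via the isometry u \<mapsto> (u-hat(k))_{k \<ge> 0}.\<close>

type_synonym seq = "nat \<Rightarrow> complex"

definition l2plus :: "seq \<Rightarrow> bool" where
  "l2plus a \<longleftrightarrow> summable (\<lambda>k. (cmod (a k))\<^sup>2)"

definition h12plus :: "seq \<Rightarrow> bool" where
  "h12plus a \<longleftrightarrow> summable (\<lambda>k. (1 + real k) * (cmod (a k))\<^sup>2)"

definition h12_norm :: "seq \<Rightarrow> real" where
  "h12_norm a = sqrt (\<Sum>k. (1 + real k) * (cmod (a k))\<^sup>2)"

definition l2_inner :: "seq \<Rightarrow> seq \<Rightarrow> complex" where
  "l2_inner f g = (\<Sum>k. f k * cnj (g k))"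

definition one_seq :: seq where
  "one_seq = (\<lambda>k. if k = 0 then 1 else 0)"

text \<open>Fourier coefficients of Pi(|u|^2 u) = Pi(u^2 conj u) for u in H^{1/2}_+:
  the n-th coefficient is (u^2 | S^n u) = sum_k conj(u_k) (u*u)_{n+k}.\<close>
definition szego_nl :: "seq \<Rightarrow> seq" where
  "szego_nl a n = (\<Sum>k. cnj (a k) * (\<Sum>j\<le>n + k. a j * a (n + k - j)))"

definition szego_solution :: "(real \<Rightarrow> seq) \<Rightarrow> seq \<Rightarrow> bool" where
  "szego_solution u u0 \<longleftrightarrow>
     u 0 = u0 \<and> (\<forall>t. h12plus (u t)) \<and>
     (\<forall>t. ((\<lambda>s. h12_norm (\<lambda>k. u s k - u t k)) \<longlongrightarrow> 0) (at t)) \<and>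
     (\<forall>t n. ((\<lambda>s. \<i> * u s n) has_vector_derivative szego_nl (u t) n) (at t))"

text \<open>Hankel operator H_u h = Pi(u conj h), K_u = H_u S, adjoint shift S^*.\<close>
definition hankel :: "seq \<Rightarrow> seq \<Rightarrow> seq" where
  "hankel a h n = (\<Sum>k. a (n + k) * cnj (h k))"

definition shift_adj :: "seq \<Rightarrow> seq" where
  "shift_adj h n = h (Suc n)"

definition shift :: "seq \<Rightarrow> seq" where
  "shift h n = (if n = 0 then 0 else h (n - 1))"

definition kop :: "seq \<Rightarrow> seq \<Rightarrow> seq" where
  "kop a h = hankel a (shift h)"

definition op_exp :: "(seq \<Rightarrow> seq) \<Rightarrow> complex \<Rightarrow> seq \<Rightarrow> seq" where
  "op_exp A c h m = (\<Sum>n. (c ^ n / of_nat (fact n)) * (A ^^ n) h m)"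

definition resolvent :: "complex \<Rightarrow> (seq \<Rightarrow> seq) \<Rightarrow> seq \<Rightarrow> seq" where
  "resolvent z B w = (THE x. l2plus x \<and> (\<forall>n. x n - z * B x n = w n))"

definition disc_ext :: "seq \<Rightarrow> complex \<Rightarrow> complex" where
  "disc_ext a z = (\<Sum>k. a k * z ^ k)"

end

theory Submission
  imports Defs
begin

text \<open>
  Let \<open>T\<close> be the Toeplitz operator of symbol \<open>\<bar>u\<bar>\<^sup>2\<close> and \<open>A = - \<i> T\<close>. The equation reads \<open>u' = A u\<close>, and
  \<open>H\<^sub>u\<^sup>2\<close>, \<open>K\<^sub>u\<^sup>2\<close> satisfy the Lax equations \<open>Q' = [A, Q]\<close>, while the adjoint shift \<open>S\<^sup>*\<close> satisfies
  \<open>0 = [A, S\<^sup>*] - \<i> (S\<^sup>* H\<^sub>u\<^sup>2 - K\<^sub>u\<^sup>2 S\<^sup>*)\<close> and \<open>T 1 = H\<^sub>u\<^sup>2 1\<close>. Conjugating formally by the flow of \<open>A\<close> therefore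
  replaces \<open>H\<^sub>u\<^sup>2\<close>, \<open>K\<^sub>u\<^sup>2\<close> by their initial values, \<open>S\<^sup>*\<close> by
  \<open>X(t) = exp(\<i> t K\<^sup>2) S\<^sup>* exp(- \<i> t H\<^sup>2)\<close> and the functional \<open>(\<cdot> | 1)\<close> by \<open>(exp(- \<i> t H\<^sup>2) \<cdot> | 1)\<close>.

  For data in \<open>H\<^sup>1\<^sup>/\<^sup>2\<close> the operator \<open>T\<close> is unbounded and its flow is avoided: for every word \<open>w\<close> in
  \<open>H\<^sub>u\<^sup>2\<close>, \<open>K\<^sub>u\<^sup>2\<close>, \<open>S\<^sup>*\<close> the moment \<open>(w u | 1)\<close> is differentiable, \<open>T\<close> cancels from its derivative, and the
  moments solve a closed linear hierarchy with the unique solution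
  \<open>(exp(- \<i> t H\<^sup>2) w(H\<^sup>2, K\<^sup>2, X(t)) u\<^sub>0 | 1)\<close>. The words \<open>(S\<^sup>*)\<^sup>n\<close> give the Fourier coefficients of \<open>u(t)\<close>,
  and unitarity of the exponentials makes the Neumann series of the resolvent converge for \<open>\<bar>z\<bar> < 1\<close>.
\<close>

section \<open>Weighted sequence spaces\<close>

text \<open>The weight is indexed by a type, so that each weighted space is a type of its own and
  can become an instance of \<open>banach\<close>. The lower bound makes coefficients continuous
  functionals, monotonicity makes the adjoint shift a contraction, and doubling makes the shift
  bounded.\<close>

class weight =
  fixes weight :: "'a itself \<Rightarrow> nat \<Rightarrow> real"
  assumes weight_ge_1: "1 \<le> weight T k"
    and weight_le_Suc: "weight T k \<le> weight T (Suc k)"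
    and weight_Suc_le: "weight T (Suc k) \<le> 2 * weight T k"
begin

lemma weight_nonneg [simp]: "0 \<le> weight T k"
  using weight_ge_1[of T k] by linarith

lemma weight_pos [simp]: "0 < weight T k"
  using weight_ge_1[of T k] by linarith

lemma weight_neq_0 [simp]: "weight T k \<noteq> 0"
  using weight_ge_1[of T k] by auto

end

typedef (overloaded) ('w::weight) wl2 =
  "{a::seq. summable (\<lambda>k. weight TYPE('w) k * (cmod (a k))\<^sup>2)}"
  morphisms cf Abs_wl2
  by (intro exI[of _ "\<lambda>_. 0"]) simp

lemma cf_Abs: "summable (\<lambda>k. weight TYPE('w) k * (cmod (a k))\<^sup>2) \<Longrightarrow> cf (Abs_wl2 a :: 'w::weight wl2) = a"
  by (simp add: Abs_wl2_inverse)

lemma wl2_eqI: "(\<And>k. cf x k = cf y k) \<Longrightarrow> x = y"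
  by (metis cf_inject ext)

lemma summable_cf: "summable (\<lambda>k. weight TYPE('w) k * (cmod (cf x k))\<^sup>2)" for x :: "'w::weight wl2"
  using cf[of x] by simp

lemma norm_mult_le_half: "norm a * norm b \<le> ((norm a)\<^sup>2 + (norm b)\<^sup>2) / 2"
  using sum_squares_bound[of "norm a" "norm b"] by simp

lemma summable_cf_mult:
  fixes x y :: "'w::weight wl2"
  shows "summable (\<lambda>k. weight TYPE('w) k * (cmod (cf x k) * cmod (cf y k)))"
proof (rule summable_comparison_test')
  show "summable (\<lambda>k. (weight TYPE('w) k * (cmod (cf x k))\<^sup>2 + weight TYPE('w) k * (cmod (cf y k))\<^sup>2) / 2)"
    by (intro summable_divide summable_add summable_cf)
  fix k :: nat
  have "weight TYPE('w) k * (cmod (cf x k) * cmod (cf y k))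
      \<le> weight TYPE('w) k * (((cmod (cf x k))\<^sup>2 + (cmod (cf y k))\<^sup>2) / 2)"
    by (intro mult_left_mono norm_mult_le_half) simp
  then show "norm (weight TYPE('w) k * (cmod (cf x k) * cmod (cf y k)))
      \<le> (weight TYPE('w) k * (cmod (cf x k))\<^sup>2 + weight TYPE('w) k * (cmod (cf y k))\<^sup>2) / 2"
    by (simp add: algebra_simps abs_mult add_divide_distrib)
qed

lemma summable_weight_add:
  fixes x y :: "'w::weight wl2"
  shows "summable (\<lambda>k. weight TYPE('w) k * (cmod (cf x k + cf y k))\<^sup>2)"
proof (rule summable_comparison_test')
  show "summable (\<lambda>k. weight TYPE('w) k * (cmod (cf x k))\<^sup>2 + 2 * (weight TYPE('w) k * (cmod (cf x k) * cmod (cf y k))) + weight TYPE('w) k * (cmod (cf y k))\<^sup>2)"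
    by (intro summable_add summable_cf summable_mult summable_cf_mult)
  fix k :: nat
  have "(cmod (cf x k + cf y k))\<^sup>2 \<le> (cmod (cf x k) + cmod (cf y k))\<^sup>2"
    by (intro power_mono norm_triangle_ineq) simp
  then have "weight TYPE('w) k * (cmod (cf x k + cf y k))\<^sup>2 \<le> weight TYPE('w) k * (cmod (cf x k) + cmod (cf y k))\<^sup>2"
    by (intro mult_left_mono) simp_all
  then show "norm (weight TYPE('w) k * (cmod (cf x k + cf y k))\<^sup>2)
    \<le> weight TYPE('w) k * (cmod (cf x k))\<^sup>2 + 2 * (weight TYPE('w) k * (cmod (cf x k) * cmod (cf y k))) + weight TYPE('w) k * (cmod (cf y k))\<^sup>2"
    by (simp add: algebra_simps power2_sum)
qed

lemma summable_weight_cmult: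
  fixes x :: "'w::weight wl2"
  shows "summable (\<lambda>k. weight TYPE('w) k * (cmod (c * cf x k))\<^sup>2)"
  using summable_mult[OF summable_cf[of x], of "(cmod c)\<^sup>2"]
  by (simp add: norm_mult power_mult_distrib algebra_simps)

instantiation wl2 :: (weight) real_vector
begin

definition "0 = (Abs_wl2 (\<lambda>_. 0) :: 'a wl2)"
definition "x + y = (Abs_wl2 (\<lambda>k. cf x k + cf y k) :: 'a wl2)"
definition "- x = (Abs_wl2 (\<lambda>k. - cf x k) :: 'a wl2)"
definition "x - y = (x + (- y) :: 'a wl2)"
definition "scaleR r x = (Abs_wl2 (\<lambda>k. of_real r * cf x k) :: 'a wl2)"

lemma cf_zero [simp]: "cf (0 :: 'a wl2) k = 0"
  by (simp add: zero_wl2_def cf_Abs)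

lemma cf_add [simp]: "cf (x + y :: 'a wl2) k = cf x k + cf y k"
  by (simp add: plus_wl2_def cf_Abs summable_weight_add)

lemma cf_uminus [simp]: "cf (- x :: 'a wl2) k = - cf x k"
  using summable_cf[of x] by (simp add: uminus_wl2_def cf_Abs)

lemma cf_diff [simp]: "cf (x - y :: 'a wl2) k = cf x k - cf y k"
  by (simp add: minus_wl2_def)

lemma cf_scaleR [simp]: "cf (scaleR r x :: 'a wl2) k = of_real r * cf x k"
  by (simp add: scaleR_wl2_def cf_Abs summable_weight_cmult del: norm_mult)

instance
  by standard (auto intro!: wl2_eqI simp: algebra_simps)

end

text \<open>The inner product is the real part of the Hermitian one: the space is treated as a real
  Hilbert space, and multiplying one argument by \<i> recovers the imaginary part.\<close>

instantiation wl2 :: (weight) real_inner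
begin

definition "inner x y = (\<Sum>k. weight TYPE('a) k * Re (cf x k * cnj (cf y k)))" for x y :: "'a wl2"
definition "norm x = sqrt (inner x x)" for x :: "'a wl2"
definition "sgn x = x /\<^sub>R norm x" for x :: "'a wl2"
definition "dist x y = norm (x - y)" for x y :: "'a wl2"
definition "uniformity = (INF e\<in>{0 <..}. principal {(x::'a wl2, y). dist x y < e})"
definition "open U \<longleftrightarrow> (\<forall>x\<in>U. eventually (\<lambda>(x'::'a wl2, y). x' = x \<longrightarrow> y \<in> U) uniformity)"

lemma summable_inner: "summable (\<lambda>k. weight TYPE('a) k * Re (cf x k * cnj (cf y k)))" for x y :: "'a wl2"
proof (rule summable_comparison_test'[OF summable_cf_mult[of x y]])
  fix k
  have "\<bar>Re (cf x k * cnj (cf y k))\<bar> \<le> cmod (cf x k) * cmod (cf y k)"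
    by (metis abs_Re_le_cmod complex_mod_cnj norm_mult)
  then show "norm (weight TYPE('a) k * Re (cf x k * cnj (cf y k))) \<le> weight TYPE('a) k * (cmod (cf x k) * cmod (cf y k))"
    by (simp add: abs_mult mult_left_mono del: times_complex.sel)
qed

lemma inner_self_wl2: "inner x x = (\<Sum>k. weight TYPE('a) k * (cmod (cf x k))\<^sup>2)" for x :: "'a wl2"
  by (simp add: inner_wl2_def complex_mult_cnj cmod_power2 flip: power2_eq_square)

instance
proof
  fix x y z :: "'a wl2" and r :: real
  show "inner x y = inner y x"
    by (simp add: inner_wl2_def mult.commute)
  show "inner (x + y) z = inner x z + inner y z"
    unfolding inner_wl2_def
    by (subst suminf_add[OF summable_inner summable_inner]) (simp add: ring_distribs add_ac)
  show "inner (scaleR r x) y = r * inner x y"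
    unfolding inner_wl2_def
    by (subst suminf_mult[OF summable_inner, symmetric]) (simp add: right_diff_distrib mult_ac)
  show "0 \<le> inner x x"
    unfolding inner_self_wl2 by (intro suminf_nonneg summable_cf) simp
  show "inner x x = 0 \<longleftrightarrow> x = 0"
  proof
    assume "inner x x = 0"
    then have "\<forall>k. weight TYPE('a) k * (cmod (cf x k))\<^sup>2 = 0"
      unfolding inner_self_wl2 by (subst (asm) suminf_eq_zero_iff[OF summable_cf]) simp_all
    then have "cf x k = 0" for k
      by simp
    then show "x = 0"
      by (intro wl2_eqI) simp
  qed (simp add: inner_self_wl2)
qed (simp_all add: norm_wl2_def sgn_wl2_def dist_wl2_def uniformity_wl2_def open_wl2_def)

end

lemma norm_wl2_sq: "(norm x)\<^sup>2 = (\<Sum>k. weight TYPE('w) k * (cmod (cf x k))\<^sup>2)" for x :: "'w::weight wl2"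
  by (metis inner_self_wl2 power2_norm_eq_inner)

text \<open>A uniform bound on partial sums of nonnegative terms yields membership and norm bound at
  once; all operators below enter the spaces this way.\<close>

lemma wl2_boundedI:
  assumes "\<And>n. (\<Sum>k<n. weight TYPE('w::weight) k * (cmod (a k))\<^sup>2) \<le> B" 
  shows "summable (\<lambda>k. weight TYPE('w) k * (cmod (a k))\<^sup>2)"
    and "(norm (Abs_wl2 a :: 'w wl2))\<^sup>2 \<le> B"
proof -
  show 1: "summable (\<lambda>k. weight TYPE('w) k * (cmod (a k))\<^sup>2)"
    by (rule summableI_nonneg_bounded[OF _ assms]) simp
  show "(norm (Abs_wl2 a :: 'w wl2))\<^sup>2 \<le> B"
    unfolding norm_wl2_sq cf_Abs[OF 1] by (rule suminf_le_const[OF 1 assms])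
qed

lemma sum_weight_le_norm: "(\<Sum>k<n. weight TYPE('w) k * (cmod (cf x k))\<^sup>2) \<le> (norm x)\<^sup>2" for x :: "'w::weight wl2"
  unfolding norm_wl2_sq by (intro sum_le_suminf summable_cf) auto

lemma norm_cf_le: "cmod (cf x k) \<le> norm x" for x :: "'w::weight wl2"
proof -
  have "1 * (cmod (cf x k))\<^sup>2 \<le> weight TYPE('w) k * (cmod (cf x k))\<^sup>2"
    by (intro mult_right_mono weight_ge_1) simp
  also have "\<dots> \<le> (\<Sum>k<Suc k. weight TYPE('w) k * (cmod (cf x k))\<^sup>2)"
    by (rule member_le_sum) auto
  also have "\<dots> \<le> (norm x)\<^sup>2"
    by (rule sum_weight_le_norm)
  finally show ?thesis
    by (intro power2_le_imp_le[of "cmod (cf x k)" "norm x"]) auto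
qed

lemma bounded_linear_cf: "bounded_linear (\<lambda>x::'w::weight wl2. cf x k)"
  by (rule bounded_linear_intro[where K = 1]) (auto simp: scaleR_conv_of_real norm_cf_le)

text \<open>The coefficients of a Cauchy sequence converge one by one. Taking the limit in finitely
  many of them first, as in \<open>bnd\<close>, keeps the estimate uniform in their number.\<close>

instance wl2 :: (weight) banach
proof
  fix X :: "nat \<Rightarrow> 'a wl2"
  assume C: "Cauchy X"
  have "Cauchy (\<lambda>n. cf (X n) k)" for k
    using bounded_linear.Cauchy[OF bounded_linear_cf C] .
  then have "convergent (\<lambda>n. cf (X n) k)" for k
    by (simp add: Cauchy_convergent)
  then obtain a where a: "\<And>k. (\<lambda>n. cf (X n) k) \<longlonglongrightarrow> a k"
    unfolding convergent_def by metis
  have bnd: "(\<Sum>k<n. weight TYPE('a) k * (cmod (a k - cf (X m) k))\<^sup>2) \<le> e\<^sup>2"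
    if e: "\<And>m' . m' \<ge> M \<Longrightarrow> norm (X m' - X m) \<le> e" for n m M e
  proof (rule LIMSEQ_le_const2)
    show "(\<lambda>m'. \<Sum>k<n. weight TYPE('a) k * (cmod (cf (X m' - X m) k))\<^sup>2)
        \<longlonglongrightarrow> (\<Sum>k<n. weight TYPE('a) k * (cmod (a k - cf (X m) k))\<^sup>2)"
      unfolding cf_diff by (intro tendsto_intros a)
    show "\<exists>N. \<forall>m'\<ge>N. (\<Sum>k<n. weight TYPE('a) k * (cmod (cf (X m' - X m) k))\<^sup>2) \<le> e\<^sup>2"
    proof (intro exI[of _ M] allI impI)
      fix m' assume "M \<le> m'"
      have "(\<Sum>k<n. weight TYPE('a) k * (cmod (cf (X m' - X m) k))\<^sup>2) \<le> (norm (X m' - X m))\<^sup>2"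
        by (rule sum_weight_le_norm)
      also have "\<dots> \<le> e\<^sup>2"
        using e[OF \<open>M \<le> m'\<close>] by (intro power_mono) auto
      finally show "(\<Sum>k<n. weight TYPE('a) k * (cmod (cf (X m' - X m) k))\<^sup>2) \<le> e\<^sup>2" .
    qed
  qed
  obtain M0 where M0: "\<And>m n. m \<ge> M0 \<Longrightarrow> n \<ge> M0 \<Longrightarrow> norm (X m - X n) < 1"
    using CauchyD[OF C zero_less_one] by blast
  \<comment> \<open>\<open>bnd\<close> only controls differences from a term of the sequence, so
    such a difference is placed in the space first and \<open>X M0\<close> is added back.\<close>
  define y where "y = (Abs_wl2 (\<lambda>k. a k - cf (X M0) k) :: 'a wl2)"
  have "cf y = (\<lambda>k. a k - cf (X M0) k)"
    unfolding y_def using M0 by (intro cf_Abs wl2_boundedI(1)[where B = "1\<^sup>2"] bnd[of M0]) (auto intro: less_imp_le)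
  then have cfa: "cf (y + X M0) k = a k" for k
    by simp
  have "X \<longlonglongrightarrow> y + X M0"
  proof (rule LIMSEQ_I)
    fix r :: real assume r: "0 < r"
    obtain M where M: "\<And>m n. m \<ge> M \<Longrightarrow> n \<ge> M \<Longrightarrow> norm (X m - X n) < r / 2"
      using CauchyD[OF C, of "r/2"] r by auto
    have "norm (X m - (y + X M0)) < r" if "m \<ge> M" for m
    proof -
      have "(\<Sum>k<n. weight TYPE('a) k * (cmod (cf (y + X M0 - X m) k))\<^sup>2) \<le> (r/2)\<^sup>2" for n
        unfolding cf_diff cfa using M that by (intro bnd[of M]) (auto intro: less_imp_le)
      then have "(norm (y + X M0 - X m))\<^sup>2 \<le> (r/2)\<^sup>2"
        unfolding norm_wl2_sq by (intro suminf_le_const summable_cf) blast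
      then have "norm (y + X M0 - X m) \<le> r / 2"
        using r by (intro power2_le_imp_le[of "norm (y + X M0 - X m)" "r / 2"]) auto
      then show ?thesis
        using r by (subst norm_minus_commute) linarith
    qed
    then show "\<exists>M. \<forall>m\<ge>M. norm (X m - (y + X M0)) < r"
      by blast
  qed
  then show "convergent X"
    by (auto simp: convergent_def)
qed

section \<open>Monomials and the expansion of an element in them\<close>

definition single :: "nat \<Rightarrow> complex \<Rightarrow> 'w::weight wl2" where
  "single n c = Abs_wl2 (\<lambda>k. if k = n then c else 0)"

lemma cf_single [simp]: "cf (single n c :: 'w::weight wl2) k = (if k = n then c else 0)"
proof -
  have "summable (\<lambda>k. weight TYPE('w) k * (cmod (if k = n then c else 0))\<^sup>2)"
    by (rule summable_finite[of "{n}"]) auto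
  then show ?thesis
    by (simp add: single_def cf_Abs)
qed

text \<open>The space is not trivial, so the identity operator has norm 1; the Banach algebra of
  operators relies on this.\<close>

instance wl2 :: (weight) perfect_space
proof
  fix x :: "'a wl2"
  show "\<not> open {x}"
  proof
    assume "open {x}"
    then obtain e where e: "e > 0" "\<And>y. dist y x < e \<Longrightarrow> y = x"
      unfolding open_dist by auto
    define v :: "'a wl2" where "v = single 0 1"
    have "cf v 0 \<noteq> cf 0 0"
      by (simp add: v_def)
    then have v: "v \<noteq> 0"
      by metis
    define y where "y = x + (e / (2 * norm v)) *\<^sub>R v"
    have "dist y x = e / 2"
      using v e(1) by (simp add: y_def dist_norm)
    then have "y = x"
      using e by simp
    then show False
      using v e(1) by (simp add: y_def)
  qed
qed

lemma cf_sum: "cf (\<Sum>i\<in>A. f i) k = (\<Sum>i\<in>A. cf (f i :: 'w::weight wl2) k)"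
  by (induction A rule: infinite_finite_induct) auto

text \<open>Monomials are orthogonal, so the squared norm of the remainder is the tail of the norm
  series.\<close>

lemma sums_single_wl2: "(\<lambda>k. single k (cf x k)) sums x" for x :: "'w::weight wl2"
proof -
  have eq: "(norm (x - (\<Sum>k<n. single k (cf x k))))\<^sup>2 = (norm x)\<^sup>2 - (\<Sum>k<n. weight TYPE('w) k * (cmod (cf x k))\<^sup>2)" for n
  proof -
    have c: "cf (x - (\<Sum>k<n. single k (cf x k))) k = (if k < n then 0 else cf x k)" for k
      by (auto simp: cf_sum)
    have "(norm (x - (\<Sum>k<n. single k (cf x k))))\<^sup>2 = (\<Sum>k. weight TYPE('w) k * (cmod (cf x k))\<^sup>2 - (if k \<in> {..<n} then weight TYPE('w) k * (cmod (cf x k))\<^sup>2 else 0))"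
      unfolding norm_wl2_sq c by (rule suminf_cong) auto
    also have "\<dots> = (\<Sum>k. weight TYPE('w) k * (cmod (cf x k))\<^sup>2) - (\<Sum>k. if k \<in> {..<n} then weight TYPE('w) k * (cmod (cf x k))\<^sup>2 else 0)"
      by (rule suminf_diff[symmetric, OF summable_cf sums_summable[OF sums_If_finite_set]]) simp
    also have "(\<Sum>k. if k \<in> {..<n} then weight TYPE('w) k * (cmod (cf x k))\<^sup>2 else 0) = (\<Sum>k<n. weight TYPE('w) k * (cmod (cf x k))\<^sup>2)"
      by (rule sums_unique[symmetric, OF sums_If_finite_set]) simp
    finally show ?thesis
      by (simp add: norm_wl2_sq)
  qed
  have "(\<lambda>n. (norm (x - (\<Sum>k<n. single k (cf x k))))\<^sup>2) \<longlonglongrightarrow> (norm x)\<^sup>2 - (norm x)\<^sup>2"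
    unfolding eq by (rule tendsto_diff[OF tendsto_const summable_LIMSEQ[OF summable_cf[of x], folded norm_wl2_sq]])
  then have "(\<lambda>n. (norm (x - (\<Sum>k<n. single k (cf x k))))\<^sup>2) \<longlonglongrightarrow> 0"
    by (simp only: diff_self)
  then have "(\<lambda>n. norm (x - (\<Sum>k<n. single k (cf x k)))) \<longlonglongrightarrow> 0"
    by (rule power_tendsto_0_iff[OF pos2, THEN iffD1])
  then have "(\<lambda>n. x - (\<Sum>k<n. single k (cf x k))) \<longlonglongrightarrow> 0"
    by (rule tendsto_norm_zero_cancel)
  then have "(\<lambda>n. x - (x - (\<Sum>k<n. single k (cf x k)))) \<longlonglongrightarrow> x - 0"
    by (intro tendsto_diff tendsto_const)
  then show ?thesis
    by (simp add: sums_def)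
qed

section \<open>Bounded operators as a Banach algebra\<close>

text \<open>A copy of the bounded operators from a space to itself, on which composition can serve
  as the multiplication of a normed algebra. This makes \<open>exp\<close> and its derivative rules
  available.\<close>

typedef (overloaded) 'a endo = "UNIV :: ('a::real_normed_vector \<Rightarrow>\<^sub>L 'a) set"
  morphisms blin Endo ..

lemmas blin_simps [simp] = Endo_inverse[OF UNIV_I] blin_inverse

lemma endo_eq_iff: "A = B \<longleftrightarrow> blin A = blin B"
  by (simp add: blin_inject)

instantiation endo :: (real_normed_vector) real_vector
begin

definition "0 = Endo 0"
definition "A + B = Endo (blin A + blin B)"
definition "- A = Endo (- blin A)"
definition "A - B = Endo (blin A - blin B)"
definition "scaleR r A = Endo (scaleR r (blin A))"

lemma blin_zero [simp]: "blin (0 :: 'a endo) = 0" by (simp add: zero_endo_def)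
lemma blin_add [simp]: "blin (A + B :: 'a endo) = blin A + blin B" by (simp add: plus_endo_def)
lemma blin_uminus [simp]: "blin (- A :: 'a endo) = - blin A" by (simp add: uminus_endo_def)
lemma blin_diff [simp]: "blin (A - B :: 'a endo) = blin A - blin B" by (simp add: minus_endo_def)
lemma blin_scaleR [simp]: "blin (scaleR r A :: 'a endo) = scaleR r (blin A)" by (simp add: scaleR_endo_def)

instance
  by standard (simp_all add: endo_eq_iff scaleR_add_left scaleR_add_right)

end

instantiation endo :: (real_normed_vector) real_normed_vector
begin

definition "norm A = norm (blin A)"
definition "sgn A = A /\<^sub>R norm A" for A :: "'a endo"
definition "dist A B = norm (A - B)" for A B :: "'a endo"
definition "uniformity = (INF e\<in>{0 <..}. principal {(x::'a endo, y). dist x y < e})"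
definition "open U \<longleftrightarrow> (\<forall>x\<in>U. eventually (\<lambda>(x'::'a endo, y). x' = x \<longrightarrow> y \<in> U) uniformity)"

instance
proof
  fix A B :: "'a endo"
  show "norm (A + B) \<le> norm A + norm B"
    by (simp add: norm_endo_def norm_triangle_ineq)
qed (simp_all add: endo_eq_iff norm_endo_def sgn_endo_def dist_endo_def uniformity_endo_def open_endo_def)

end

instance endo :: (banach) banach
proof
  fix X :: "nat \<Rightarrow> 'a endo"
  assume "Cauchy X"
  then have "Cauchy (\<lambda>n. blin (X n))"
    by (simp add: Cauchy_iff norm_endo_def)
  then obtain L where "(\<lambda>n. blin (X n)) \<longlonglongrightarrow> L"
    using Cauchy_convergent[of "\<lambda>n. blin (X n)"] by (auto simp: convergent_def)
  then have "X \<longlonglongrightarrow> Endo L"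
    by (simp add: LIMSEQ_iff norm_endo_def)
  then show "convergent X"
    by (auto simp: convergent_def)
qed

lemma blinfun_compose_assoc: "(a o\<^sub>L b) o\<^sub>L c = a o\<^sub>L (b o\<^sub>L c)"
  by (rule blinfun_eqI) simp

lemma id_blinfun_compose: "id_blinfun o\<^sub>L a = a" "a o\<^sub>L id_blinfun = a"
  by (rule blinfun_eqI; simp)+

instantiation endo :: ("{real_normed_vector, perfect_space}") real_normed_algebra_1
begin

definition "1 = Endo id_blinfun"
definition "A * B = Endo (blin A o\<^sub>L blin B)"

lemma blin_one [simp]: "blin (1 :: 'a endo) = id_blinfun" by (simp add: one_endo_def)
lemma blin_mult [simp]: "blin (A * B :: 'a endo) = blin A o\<^sub>L blin B" by (simp add: times_endo_def)

instance
proof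
  fix A B :: "'a endo"
  show "norm (A * B) \<le> norm A * norm B"
    by (simp add: norm_endo_def norm_blinfun_compose)
  show "(0::'a endo) \<noteq> 1"
    by (metis blin_one blin_zero norm_blinfun_id norm_zero zero_neq_one)
qed (simp_all add: endo_eq_iff norm_endo_def blinfun_compose_assoc
      bounded_bilinear.add_left[OF bounded_bilinear_blinfun_compose]
      bounded_bilinear.add_right[OF bounded_bilinear_blinfun_compose]
      bounded_bilinear.scaleR_left[OF bounded_bilinear_blinfun_compose]
      bounded_bilinear.scaleR_right[OF bounded_bilinear_blinfun_compose]
      id_blinfun_compose)

end

definition app :: "'a::real_normed_vector endo \<Rightarrow> 'a \<Rightarrow> 'a" where
  "app A = blinfun_apply (blin A)"

definition mk_endo :: "('a \<Rightarrow> 'a) \<Rightarrow> 'a::real_normed_vector endo" where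
  "mk_endo f = Endo (Blinfun f)"

lemma app_mk_endo: "bounded_linear f \<Longrightarrow> app (mk_endo f) = f"
  by (simp add: app_def mk_endo_def bounded_linear_Blinfun_apply)

lemma endo_eqI: "(\<And>x. app A x = app B x) \<Longrightarrow> A = B"
  unfolding endo_eq_iff app_def by (rule blinfun_eqI)

lemma norm_app_le: "norm (app A x) \<le> norm A * norm x"
  unfolding app_def norm_endo_def by (rule norm_blinfun)

lemma norm_endo_bound: "0 \<le> b \<Longrightarrow> (\<And>x. norm (app A x) \<le> b * norm x) \<Longrightarrow> norm A \<le> b"
  unfolding app_def norm_endo_def by (rule norm_blinfun_bound)

lemma bounded_bilinear_app: "bounded_bilinear app"
proof
  show "\<exists>K. \<forall>A x. norm (app A x) \<le> norm A * norm x * K"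
    by (rule exI[of _ 1]) (simp add: norm_app_le)
qed (simp_all only: app_def blin_add blin_scaleR blinfun.add_left blinfun.add_right
    blinfun.scaleR_left blinfun.scaleR_right)

interpretation app: bounded_bilinear app
  by (rule bounded_bilinear_app)

lemma app_one [simp]: "app 1 x = x"
  by (simp add: app_def)

lemma app_mult [simp]: "app (A * B) x = app A (app B x)"
  by (simp add: app_def)

section \<open>Hankel operators and convolution\<close>

text \<open>The rectangle \<open>n < N\<close>, \<open>k < K\<close> lies in the triangle
  \<open>n + k < N + K\<close>, which is then summed along antidiagonals.\<close>

lemma sum_rect_le_triangle:
  fixes f :: "nat \<Rightarrow> nat \<Rightarrow> real"
  assumes "\<And>i j. 0 \<le> f i j"
  shows "(\<Sum>n<N. \<Sum>k<K. f n k) \<le> (\<Sum>m<N + K. \<Sum>k\<le>m. f (m - k) k)"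
proof -
  have fin: "finite {(i, j). i + j < N + K}"
    by (rule finite_subset[of _ "{..<N + K} \<times> {..<N + K}"]) auto
  have "(\<Sum>n<N. \<Sum>k<K. f n k) = (\<Sum>(k, n)\<in>{..<K} \<times> {..<N}. f n k)"
    by (subst sum.swap) (simp add: sum.cartesian_product)
  also have "\<dots> \<le> (\<Sum>(k, n)\<in>{(i, j). i + j < N + K}. f n k)"
    using fin assms by (intro sum_mono2) auto
  also have "\<dots> = (\<Sum>m<N + K. \<Sum>k\<le>m. f (m - k) k)"
    by (rule sum.triangle_reindex)
  finally show ?thesis .
qed

lemma sum_triangle_le_rect:
  fixes f g :: "nat \<Rightarrow> real"
  assumes "\<And>i. 0 \<le> f i" "\<And>i. 0 \<le> g i"
  shows "(\<Sum>m<N. \<Sum>k\<le>m. f k * g (m - k)) \<le> (\<Sum>i<N. f i) * (\<Sum>j<N. g j)"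
proof -
  have "(\<Sum>m<N. \<Sum>k\<le>m. f k * g (m - k)) = (\<Sum>(i, j)\<in>{(i, j). i + j < N}. f i * g j)"
    by (rule sum.triangle_reindex[symmetric])
  also have "\<dots> \<le> (\<Sum>(i, j)\<in>{..<N} \<times> {..<N}. f i * g j)"
    using assms by (intro sum_mono2) auto
  also have "\<dots> = (\<Sum>i<N. f i) * (\<Sum>j<N. g j)"
    by (simp add: sum_product sum.cartesian_product)
  finally show ?thesis .
qed

section \<open>Weighted estimates for Hankel matrices and convolutions\<close>

lemma Cauchy_Schwarz_weighted:
  fixes x y q :: "nat \<Rightarrow> real"
  assumes "\<And>k. 0 < q k"
  shows "(\<Sum>k\<in>A. x k * y k)\<^sup>2 \<le> (\<Sum>k\<in>A. (x k)\<^sup>2 / q k) * (\<Sum>k\<in>A. q k * (y k)\<^sup>2)"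
proof -
  have pos: "0 \<le> q k" "q k \<noteq> 0" for k
    using assms[of k] by auto
  have "(\<Sum>k\<in>A. x k * y k) = (\<Sum>k\<in>A. (x k / sqrt (q k)) * (sqrt (q k) * y k))"
    using pos by (intro sum.cong) auto
  also have "\<dots>\<^sup>2 \<le> (\<Sum>k\<in>A. (x k / sqrt (q k))\<^sup>2) * (\<Sum>k\<in>A. (sqrt (q k) * y k)\<^sup>2)"
    by (rule Cauchy_Schwarz_ineq_sum)
  also have "\<dots> = (\<Sum>k\<in>A. (x k)\<^sup>2 / q k) * (\<Sum>k\<in>A. q k * (y k)\<^sup>2)"
    using pos by (simp add: power_divide power_mult_distrib)
  finally show ?thesis .
qed

text \<open>Apply Cauchy-Schwarz with weight \<open>q\<close> in each row, then sum the rows with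
  weight \<open>p\<close>. Grouped by \<open>m = n + k\<close>, the coefficient \<open>a m\<close>
  collects the total weight bounded by \<open>d m\<close>.\<close>

lemma hankel_weighted_bound:
  fixes p q d :: "nat \<Rightarrow> real" and a h :: seq
  assumes p: "\<And>k. 0 < p k" and q: "\<And>k. 0 < q k"
    and d: "\<And>m. (\<Sum>k\<le>m. p (m - k) / q k) \<le> d m"
    and A: "\<And>n. (\<Sum>m<n. d m * (cmod (a m))\<^sup>2) \<le> A"
    and B: "\<And>n. (\<Sum>k<n. q k * (cmod (h k))\<^sup>2) \<le> B"
  shows "summable (\<lambda>k. cmod (a (n + k) * cnj (h k)))"
    and "(\<Sum>n<N. p n * (cmod (hankel a h n))\<^sup>2) \<le> A * B"
proof -
  define s where "s n K = (\<Sum>k<K. cmod (a (n + k)) * cmod (h k))" for n K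
  have s_nonneg: "0 \<le> s n K" for n K
    by (auto simp: s_def intro!: sum_nonneg)
  have pq: "0 \<le> p n" "0 \<le> q n" "q n \<noteq> 0" "p n \<noteq> 0" for n
    using p[of n] q[of n] by auto
  have B0: "0 \<le> B"
    using B[of 0] by simp
  \<comment> \<open>Rows are cut off at \<open>K\<close> because convergence of the full rows is
    itself deduced from this bound.\<close>
  have fin: "(\<Sum>n<N. p n * (s n K)\<^sup>2) \<le> A * B" for N K
  proof -
    have "(s n K)\<^sup>2 \<le> (\<Sum>k<K. (cmod (a (n + k)))\<^sup>2 / q k) * B" for n
    proof -
      have "(s n K)\<^sup>2 \<le> (\<Sum>k<K. (cmod (a (n + k)))\<^sup>2 / q k) * (\<Sum>k<K. q k * (cmod (h k))\<^sup>2)"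
        unfolding s_def by (rule Cauchy_Schwarz_weighted[OF q])
      also have "\<dots> \<le> (\<Sum>k<K. (cmod (a (n + k)))\<^sup>2 / q k) * B"
        using pq by (intro mult_left_mono B sum_nonneg) auto
      finally show ?thesis .
    qed
    then have "(\<Sum>n<N. p n * (s n K)\<^sup>2) \<le> (\<Sum>n<N. p n * ((\<Sum>k<K. (cmod (a (n + k)))\<^sup>2 / q k) * B))"
      using pq by (intro sum_mono mult_left_mono) auto
    also have "\<dots> = (\<Sum>n<N. \<Sum>k<K. p n * (cmod (a (n + k)))\<^sup>2 / q k) * B"
      by (simp add: sum_distrib_left sum_distrib_right mult_ac)
    also have "\<dots> \<le> (\<Sum>m<N + K. \<Sum>k\<le>m. p (m - k) * (cmod (a (m - k + k)))\<^sup>2 / q k) * B"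
      using pq B0 by (intro mult_right_mono sum_rect_le_triangle) auto
    also have "(\<Sum>m<N + K. \<Sum>k\<le>m. p (m - k) * (cmod (a (m - k + k)))\<^sup>2 / q k)
        = (\<Sum>m<N + K. (\<Sum>k\<le>m. p (m - k) / q k) * (cmod (a m))\<^sup>2)"
      unfolding sum_distrib_right by (intro sum.cong) auto
    also have "\<dots> * B \<le> (\<Sum>m<N + K. d m * (cmod (a m))\<^sup>2) * B"
      using B0 by (intro mult_right_mono sum_mono d) auto
    also have "\<dots> \<le> A * B"
      using B0 by (intro mult_right_mono A)
    finally show ?thesis .
  qed
  have "s n K \<le> sqrt (A * B / p n)" for n K
  proof (rule real_le_rsqrt)
    have "p n * (s n K)\<^sup>2 \<le> (\<Sum>i<Suc n. p i * (s i K)\<^sup>2)"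
      using pq by (intro member_le_sum[of n _ "\<lambda>n. p n * (s n K)\<^sup>2"]) auto
    also have "\<dots> \<le> A * B"
      by (rule fin)
    finally show "(s n K)\<^sup>2 \<le> A * B / p n"
      using p[of n] by (simp add: field_simps)
  qed
  then show summ: "summable (\<lambda>k. cmod (a (n + k) * cnj (h k)))" for n
    by (intro summableI_nonneg_bounded[where x = "sqrt (A * B / p n)"]) (auto simp: s_def norm_mult)
  have "cmod (hankel a h n) \<le> (\<Sum>k. cmod (a (n + k) * cnj (h k)))" for n
    unfolding hankel_def by (rule summable_norm[OF summ])
  then have "(\<Sum>n<N. p n * (cmod (hankel a h n))\<^sup>2)
      \<le> (\<Sum>n<N. p n * (\<Sum>k. cmod (a (n + k) * cnj (h k)))\<^sup>2)"
    using pq by (intro sum_mono mult_left_mono power_mono) auto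
  also have "\<dots> \<le> A * B"
  proof (rule LIMSEQ_le_const2)
    show "(\<lambda>K. \<Sum>n<N. p n * (s n K)\<^sup>2) \<longlonglongrightarrow> (\<Sum>n<N. p n * (\<Sum>k. cmod (a (n + k) * cnj (h k)))\<^sup>2)"
      by (intro tendsto_sum tendsto_mult tendsto_const tendsto_power)
        (use summable_LIMSEQ[OF summ] in \<open>simp add: s_def norm_mult\<close>)
    show "\<exists>M. \<forall>K\<ge>M. (\<Sum>n<N. p n * (s n K)\<^sup>2) \<le> A * B"
      using fin by blast
  qed
  finally show "(\<Sum>n<N. p n * (cmod (hankel a h n))\<^sup>2) \<le> A * B" .
qed

definition conv :: "seq \<Rightarrow> seq \<Rightarrow> seq" where
  "conv a b n = (\<Sum>j\<le>n. a j * b (n - j))"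

text \<open>Cauchy-Schwarz on each antidiagonal with weight \<open>q k * r (n - k)\<close> leaves
  the sum bounded by \<open>C\<close>, times a Cauchy product of the two norm series.\<close>

lemma conv_weighted_bound:
  fixes p q r :: "nat \<Rightarrow> real" and a b :: seq
  assumes p: "\<And>k. 0 < p k" and q: "\<And>k. 0 < q k" and r: "\<And>k. 0 < r k"
    and C: "\<And>m. p m * (\<Sum>k\<le>m. 1 / (q k * r (m - k))) \<le> C"
    and A: "\<And>n. (\<Sum>k<n. q k * (cmod (a k))\<^sup>2) \<le> A"
    and B: "\<And>n. (\<Sum>k<n. r k * (cmod (b k))\<^sup>2) \<le> B"
  shows "(\<Sum>n<N. p n * (cmod (conv a b n))\<^sup>2) \<le> C * (A * B)"
proof -
  have pos: "0 \<le> p k" "0 \<le> q k" "0 \<le> r k" "q k \<noteq> 0" "r k \<noteq> 0" for k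
    using p[of k] q[of k] r[of k] by auto
  have AB: "0 \<le> A" "0 \<le> B"
    using A[of 0] B[of 0] by simp_all
  have "0 \<le> p 0 * (\<Sum>k\<le>0. 1 / (q k * r (0 - k)))"
    using pos by (intro mult_nonneg_nonneg sum_nonneg) auto
  then have C0: "0 \<le> C"
    using C[of 0] by linarith
  have "p n * (cmod (conv a b n))\<^sup>2 \<le> C * (\<Sum>k\<le>n. (q k * (cmod (a k))\<^sup>2) * (r (n - k) * (cmod (b (n - k)))\<^sup>2))" for n
  proof -
    have "(cmod (conv a b n))\<^sup>2 \<le> (\<Sum>k\<le>n. 1 * (cmod (a k) * cmod (b (n - k))))\<^sup>2"
      unfolding conv_def
      by (intro power_mono norm_ge_zero order_trans[OF norm_sum]) (simp add: norm_mult)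
    also have "\<dots> \<le> (\<Sum>k\<in>{..n}. 1\<^sup>2 / (q k * r (n - k)))
        * (\<Sum>k\<in>{..n}. (q k * r (n - k)) * (cmod (a k) * cmod (b (n - k)))\<^sup>2)"
      using q r by (intro Cauchy_Schwarz_weighted) auto
    also have "\<dots> = (\<Sum>k\<le>n. 1 / (q k * r (n - k)))
        * (\<Sum>k\<le>n. (q k * (cmod (a k))\<^sup>2) * (r (n - k) * (cmod (b (n - k)))\<^sup>2))"
    proof -
      have "x * y * (a * b)\<^sup>2 = (x * a\<^sup>2) * (y * b\<^sup>2)" for x y a b :: real
        by algebra
      then show ?thesis
        by (simp only: power_one)
    qed
    finally have "p n * (cmod (conv a b n))\<^sup>2 \<le> p n * (\<Sum>k\<le>n. 1 / (q k * r (n - k)))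
        * (\<Sum>k\<le>n. (q k * (cmod (a k))\<^sup>2) * (r (n - k) * (cmod (b (n - k)))\<^sup>2))"
      using pos by (simp add: mult_left_mono mult.assoc)
    also have "\<dots> \<le> C * (\<Sum>k\<le>n. (q k * (cmod (a k))\<^sup>2) * (r (n - k) * (cmod (b (n - k)))\<^sup>2))"
      using pos by (intro mult_right_mono C sum_nonneg mult_nonneg_nonneg) auto
    finally show ?thesis .
  qed
  then have "(\<Sum>n<N. p n * (cmod (conv a b n))\<^sup>2)
      \<le> C * (\<Sum>n<N. \<Sum>k\<le>n. (q k * (cmod (a k))\<^sup>2) * (r (n - k) * (cmod (b (n - k)))\<^sup>2))"
    unfolding sum_distrib_left[of C] by (intro sum_mono)
  also have "\<dots> \<le> C * ((\<Sum>k<N. q k * (cmod (a k))\<^sup>2) * (\<Sum>k<N. r k * (cmod (b k))\<^sup>2))"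
    using pos C0 by (intro mult_left_mono sum_triangle_le_rect) auto
  also have "\<dots> \<le> C * (A * B)"
    using pos C0 AB by (intro mult_left_mono mult_mono A B sum_nonneg) auto
  finally show ?thesis .
qed

text \<open>The three weights are independent. The value is meaningful where a locale below proves
  that the resulting coefficients lie in the target space; the same holds for \<open>prodw\<close>
  and \<open>emb\<close>.\<close>

definition hank :: "'u::weight wl2 \<Rightarrow> 'v::weight wl2 \<Rightarrow> 'w::weight wl2" where
  "hank a f = Abs_wl2 (hankel (cf a) (cf f))"

definition prodw :: "'u::weight wl2 \<Rightarrow> 'v::weight wl2 \<Rightarrow> 'w::weight wl2" where
  "prodw a f = Abs_wl2 (conv (cf a) (cf f))"

definition emb :: "'u::weight wl2 \<Rightarrow> 'w::weight wl2" where
  "emb a = Abs_wl2 (cf a)"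

lemma norm_le_sqrt_mult:
  assumes "x\<^sup>2 \<le> C * (a\<^sup>2 * b\<^sup>2)" "0 \<le> a" "0 \<le> b" "0 \<le> (C::real)"
  shows "x \<le> a * b * sqrt C"
proof (rule power2_le_imp_le)
  show "x\<^sup>2 \<le> (a * b * sqrt C)\<^sup>2"
    using assms by (simp add: power_mult_distrib mult_ac)
  show "0 \<le> a * b * sqrt C"
    using assms by simp
qed

locale hankel_weights =
  fixes u :: "'u::weight itself" and v :: "'v::weight itself" and w :: "'w::weight itself" and C :: real
  assumes C_pos: "0 < C"
    and C: "\<And>m. (\<Sum>k\<le>m. weight TYPE('w) (m - k) / weight TYPE('v) k) \<le> C * weight TYPE('u) m"
begin

lemma sum_le: "(\<Sum>m<n. C * weight TYPE('u) m * (cmod (cf a m))\<^sup>2) \<le> C * (norm a)\<^sup>2" for a :: "'u wl2"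
  using mult_left_mono[OF sum_weight_le_norm[where x = a], of C n] C_pos
  by (simp add: sum_distrib_left mult.assoc)

lemma summable_hank: "summable (\<lambda>k. cf a (n + k) * cnj (cf f k))" for a :: "'u wl2" and f :: "'v wl2"
  by (rule summable_norm_cancel, rule hankel_weighted_bound(1)[OF weight_pos weight_pos C sum_le sum_weight_le_norm])

lemma hankel_bound: "(\<Sum>n<N. weight TYPE('w) n * (cmod (hankel (cf a) (cf f) n))\<^sup>2) \<le> C * (norm a)\<^sup>2 * (norm f)\<^sup>2"
  for a :: "'u wl2" and f :: "'v wl2"
  by (rule hankel_weighted_bound(2)[OF weight_pos weight_pos C sum_le sum_weight_le_norm])

lemma cf_hank: "cf (hank a f :: 'w wl2) = hankel (cf a) (cf f)" for a :: "'u wl2" and f :: "'v wl2"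
  unfolding hank_def by (rule cf_Abs[OF wl2_boundedI(1)[OF hankel_bound]])

lemma norm_hank_le: "norm (hank a f :: 'w wl2) \<le> norm a * norm f * sqrt C" for a :: "'u wl2" and f :: "'v wl2"
proof -
  have "(norm (hank a f :: 'w wl2))\<^sup>2 \<le> C * (norm a)\<^sup>2 * (norm f)\<^sup>2"
    unfolding hank_def by (intro wl2_boundedI(2) hankel_bound)
  then show ?thesis
    using C_pos by (intro norm_le_sqrt_mult) (auto simp: mult.assoc)
qed

lemma bounded_bilinear_hank: "bounded_bilinear (hank :: 'u wl2 \<Rightarrow> 'v wl2 \<Rightarrow> 'w wl2)"
proof
  fix a a' :: "'u wl2" and b b' :: "'v wl2" and r :: real
  show "hank (a + a') b = (hank a b + hank a' b :: 'w wl2)"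
    by (rule wl2_eqI) (simp add: cf_hank hankel_def ring_distribs suminf_add summable_hank)
  show "hank a (b + b') = (hank a b + hank a b' :: 'w wl2)"
    by (rule wl2_eqI) (simp add: cf_hank hankel_def ring_distribs suminf_add summable_hank)
  show "hank (scaleR r a) b = (scaleR r (hank a b) :: 'w wl2)"
    by (rule wl2_eqI) (simp add: cf_hank hankel_def suminf_mult[OF summable_hank, symmetric] mult.assoc)
  show "hank a (scaleR r b) = (scaleR r (hank a b) :: 'w wl2)"
    by (rule wl2_eqI) (simp add: cf_hank hankel_def suminf_mult[OF summable_hank, symmetric] mult.left_commute)
  show "\<exists>K. \<forall>(a::'u wl2) (b::'v wl2). norm (hank a b :: 'w wl2) \<le> norm a * norm b * K"
    using norm_hank_le by blast
qed

end

locale conv_weights =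
  fixes u :: "'u::weight itself" and v :: "'v::weight itself" and w :: "'w::weight itself" and C :: real
  assumes C_pos: "0 < C"
    and C: "\<And>m. weight TYPE('w) m * (\<Sum>k\<le>m. 1 / (weight TYPE('u) k * weight TYPE('v) (m - k))) \<le> C"
begin

lemma conv_bound: "(\<Sum>n<N. weight TYPE('w) n * (cmod (conv (cf a) (cf f) n))\<^sup>2) \<le> C * ((norm a)\<^sup>2 * (norm f)\<^sup>2)"
  for a :: "'u wl2" and f :: "'v wl2"
  by (rule conv_weighted_bound[OF weight_pos weight_pos weight_pos C sum_weight_le_norm sum_weight_le_norm])

lemma cf_prodw: "cf (prodw a f :: 'w wl2) = conv (cf a) (cf f)" for a :: "'u wl2" and f :: "'v wl2"
  unfolding prodw_def by (rule cf_Abs[OF wl2_boundedI(1)[OF conv_bound]])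

lemma norm_prodw_le: "norm (prodw a f :: 'w wl2) \<le> norm a * norm f * sqrt C" for a :: "'u wl2" and f :: "'v wl2"
proof -
  have "(norm (prodw a f :: 'w wl2))\<^sup>2 \<le> C * ((norm a)\<^sup>2 * (norm f)\<^sup>2)"
    unfolding prodw_def by (intro wl2_boundedI(2) conv_bound)
  then show ?thesis
    using C_pos by (intro norm_le_sqrt_mult) auto
qed

lemma bounded_bilinear_prodw: "bounded_bilinear (prodw :: 'u wl2 \<Rightarrow> 'v wl2 \<Rightarrow> 'w wl2)"
proof
  fix a a' :: "'u wl2" and b b' :: "'v wl2" and r :: real
  show "prodw (a + a') b = (prodw a b + prodw a' b :: 'w wl2)"
    by (rule wl2_eqI) (simp add: cf_prodw conv_def ring_distribs sum.distrib)
  show "prodw a (b + b') = (prodw a b + prodw a b' :: 'w wl2)"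
    by (rule wl2_eqI) (simp add: cf_prodw conv_def ring_distribs sum.distrib)
  show "prodw (scaleR r a) b = (scaleR r (prodw a b) :: 'w wl2)"
    by (rule wl2_eqI) (simp add: cf_prodw conv_def sum_distrib_left mult_ac)
  show "prodw a (scaleR r b) = (scaleR r (prodw a b) :: 'w wl2)"
    by (rule wl2_eqI) (simp add: cf_prodw conv_def sum_distrib_left mult_ac)
  show "\<exists>K. \<forall>(a::'u wl2) (b::'v wl2). norm (prodw a b :: 'w wl2) \<le> norm a * norm b * K"
    using norm_prodw_le by blast
qed

end

locale emb_weights =
  fixes u :: "'u::weight itself" and w :: "'w::weight itself"
  assumes le: "\<And>m. weight TYPE('w) m \<le> weight TYPE('u) m"
begin

lemma emb_bound: "(\<Sum>n<N. weight TYPE('w) n * (cmod (cf a n))\<^sup>2) \<le> (norm a)\<^sup>2" for a :: "'u wl2"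
  by (rule order_trans[OF sum_mono sum_weight_le_norm]) (intro mult_right_mono le; simp)

lemma cf_emb: "cf (emb a :: 'w wl2) = cf a" for a :: "'u wl2"
  unfolding emb_def by (rule cf_Abs[OF wl2_boundedI(1)[OF emb_bound]])

lemma norm_emb_le: "norm (emb a :: 'w wl2) \<le> norm a" for a :: "'u wl2"
proof -
  have "(norm (emb a :: 'w wl2))\<^sup>2 \<le> (norm a)\<^sup>2"
    unfolding emb_def by (intro wl2_boundedI(2) emb_bound)
  then show ?thesis
    by (rule power2_le_imp_le) simp
qed

lemma bounded_linear_emb: "bounded_linear (emb :: 'u wl2 \<Rightarrow> 'w wl2)"
  by (rule bounded_linear_intro[where K = 1]) (auto intro!: wl2_eqI simp: cf_emb norm_emb_le)

end

subsection \<open>The three spaces\<close>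

text \<open>These are \<open>L\<^sup>2\<close>, \<open>H\<^sup>1\<^sup>/\<^sup>4\<close> and \<open>H\<^sup>1\<^sup>/\<^sup>2\<close>. The exponent \<open>1/4\<close> is chosen so that products of two
  elements lie in \<open>L\<^sup>2\<close> while Hankel operators with symbol in \<open>H\<^sup>1\<^sup>/\<^sup>2\<close> still act boundedly
  (the same estimate on \<open>H\<^sup>1\<^sup>/\<^sup>2\<close> itself diverges logarithmically).\<close>

typedef w_zero = "UNIV :: unit set" ..
typedef w_quarter = "UNIV :: unit set" ..
typedef w_half = "UNIV :: unit set" ..

instantiation w_zero :: weight
begin
definition "weight (T :: w_zero itself) k = 1"
instance by standard (auto simp: weight_w_zero_def)
end

instantiation w_quarter :: weight
begin
definition "weight (T :: w_quarter itself) k = sqrt (1 + real k)"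
instance
proof
  fix T :: "w_quarter itself" and k :: nat
  have "sqrt (1 + real (Suc k)) \<le> sqrt (4 * (1 + real k))"
    by (intro real_sqrt_le_mono) simp
  then show "weight T (Suc k) \<le> 2 * weight T k"
    unfolding weight_w_quarter_def by (simp only: real_sqrt_mult real_sqrt_four)
qed (auto simp: weight_w_quarter_def)
end

instantiation w_half :: weight
begin
definition "weight (T :: w_half itself) k = 1 + real k"
instance by standard (auto simp: weight_w_half_def)
end

lemmas weight_simps = weight_w_zero_def weight_w_quarter_def weight_w_half_def

type_synonym ell2 = "w_zero wl2"
type_synonym quarter = "w_quarter wl2"
type_synonym half = "w_half wl2"

lemma sum_inverse_sqrt_le: "(\<Sum>k\<le>m. 1 / sqrt (1 + real k)) \<le> 2 * sqrt (1 + real m)"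
proof (induction m)
  case (Suc m)
  define a b where "a = sqrt (1 + real m)" and "b = sqrt (1 + real (Suc m))"
  have ab: "0 < a" "0 < b" "b\<^sup>2 = a\<^sup>2 + 1"
    by (auto simp: a_def b_def)
  \<comment> \<open>Since the square of \<open>b\<close> exceeds that of \<open>a\<close> by 1, this
    says \<open>2 * a * b + 1 \<le> 2 * b * b\<close>; division by \<open>b\<close> gives the
    induction increment.\<close>
  have "2 * a * b \<le> a\<^sup>2 + b\<^sup>2"
    by (rule sum_squares_bound)
  then have "2 * a + 1 / b \<le> 2 * b"
    using ab by (simp add: field_simps power2_eq_square)
  then show ?case
    using Suc by (simp add: a_def b_def)
qed simp

lemma sum_rev_atMost: "(\<Sum>k\<le>m. f (m - k)) = (\<Sum>k\<le>m. f k)" for f :: "nat \<Rightarrow> 'a::comm_monoid_add"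
  by (rule sum.reindex_bij_witness[of _ "\<lambda>k. m - k" "\<lambda>k. m - k"]) auto

text \<open>The condition under which symbols in H^{1/2} act boundedly from a space to itself. With
  the constant 2 fixed, one polymorphic interpretation covers both L2 and H^{1/4}.\<close>

class hankel_weight = weight +
  assumes hankel_weight: "(\<Sum>k\<le>m. weight T (m - k) / weight T k) \<le> 2 * (1 + real m)"

instance w_zero :: hankel_weight
  by standard (simp add: weight_simps)

instance w_quarter :: hankel_weight
proof
  fix T :: "w_quarter itself" and m :: nat
  have "(\<Sum>k\<le>m. weight T (m - k) / weight T k) \<le> (\<Sum>k\<le>m. sqrt (1 + real m) * (1 / sqrt (1 + real k)))"
    by (intro sum_mono) (auto simp: weight_simps divide_right_mono)
  also have "\<dots> \<le> sqrt (1 + real m) * (2 * sqrt (1 + real m))"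
    unfolding sum_distrib_left[symmetric] by (intro mult_left_mono sum_inverse_sqrt_le) simp
  also have "\<dots> = 2 * (sqrt (1 + real m) * sqrt (1 + real m))"
    by (simp only: mult_ac)
  also have "\<dots> = 2 * (1 + real m)"
    by (subst real_sqrt_mult_self) simp
  finally show "(\<Sum>k\<le>m. weight T (m - k) / weight T k) \<le> 2 * (1 + real m)" .
qed

global_interpretation H: hankel_weights "TYPE(w_half)" "TYPE('w::hankel_weight)" "TYPE('w)" 2
  by standard (use hankel_weight in \<open>auto simp: weight_simps\<close>)

global_interpretation HQ: hankel_weights "TYPE(w_quarter)" "TYPE(w_quarter)" "TYPE(w_zero)" 2
  by standard (use sum_inverse_sqrt_le in \<open>auto simp: weight_simps\<close>)

text \<open>An approximate partial fraction decomposition: with \<open>a\<close>, \<open>b\<close>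
  the two square roots, the sum of their squares is \<open>2 + m\<close> for every \<open>k\<close>,
  and its root is at most \<open>a + b\<close>.\<close>

global_interpretation CQ: conv_weights "TYPE(w_quarter)" "TYPE(w_quarter)" "TYPE(w_zero)" 4
proof
  fix m :: nat
  have "1 / (sqrt (1 + real k) * sqrt (1 + real (m - k)))
      \<le> (1 / sqrt (1 + real k) + 1 / sqrt (1 + real (m - k))) / sqrt (2 + real m)" if "k \<le> m" for k
  proof -
    define a b where "a = sqrt (1 + real k)" and "b = sqrt (1 + real (m - k))"
    have ab: "0 < a" "0 < b"
      by (auto simp: a_def b_def)
    have "sqrt (2 + real m) = sqrt (a\<^sup>2 + b\<^sup>2)"
      using that by (simp add: a_def b_def of_nat_diff)
    also have "\<dots> \<le> a + b"
      using sqrt_sum_squares_le_sum[of a b] ab by simp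
    finally have "sqrt (2 + real m) / (a * b * sqrt (2 + real m)) \<le> (a + b) / (a * b * sqrt (2 + real m))"
      using ab by (intro divide_right_mono) auto
    moreover have "sqrt (2 + real m) / (a * b * sqrt (2 + real m)) = 1 / (a * b)"
      by (simp add: add_nonneg_eq_0_iff)
    moreover have "(a + b) / (a * b * sqrt (2 + real m)) = (1 / a + 1 / b) / sqrt (2 + real m)"
      using ab by (simp add: field_simps)
    ultimately show ?thesis
      by (simp add: a_def b_def)
  qed
  then have "(\<Sum>k\<le>m. 1 / (sqrt (1 + real k) * sqrt (1 + real (m - k))))
      \<le> (\<Sum>k\<le>m. (1 / sqrt (1 + real k) + 1 / sqrt (1 + real (m - k))) / sqrt (2 + real m))"
    by (intro sum_mono) simp
  also have "\<dots> = 2 * (\<Sum>k\<le>m. 1 / sqrt (1 + real k)) / sqrt (2 + real m)"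
    using sum_rev_atMost[of "\<lambda>k. 1 / sqrt (1 + real k)" m]
    by (simp add: sum.distrib flip: sum_divide_distrib)
  also have "\<dots> \<le> 2 * (2 * sqrt (1 + real m)) / sqrt (2 + real m)"
    by (intro divide_right_mono mult_left_mono sum_inverse_sqrt_le) auto
  also have "\<dots> \<le> 2 * (2 * sqrt (2 + real m)) / sqrt (2 + real m)"
    by (intro divide_right_mono mult_left_mono real_sqrt_le_mono) auto
  also have "\<dots> = 4"
    by (simp add: add_nonneg_eq_0_iff)
  finally show "weight TYPE(w_zero) m * (\<Sum>k\<le>m. 1 / (weight TYPE(w_quarter) k * weight TYPE(w_quarter) (m - k))) \<le> 4"
    by (simp add: weight_simps)
qed simp

global_interpretation CH: conv_weights "TYPE(w_half)" "TYPE(w_half)" "TYPE(w_quarter)" 4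
proof
  fix m :: nat
  have "(\<Sum>k\<le>m. 1 / ((1 + real k) * (1 + real (m - k))))
      = (\<Sum>k\<le>m. (1 / (1 + real k) + 1 / (1 + real (m - k))) / (2 + real m))"
  proof (intro sum.cong refl)
    fix k assume "k \<in> {..m}"
    then have m: "2 + real m = (1 + real k) + (1 + real (m - k))"
      by (simp add: of_nat_diff)
    have pf: "1 / (a * b) = (1 / a + 1 / b) / (a + b)" if "0 < a" "0 < b" for a b :: real
    proof -
      have "1 / a + 1 / b = (a + b) / (a * b)"
        using that by (simp add: field_simps)
      then show ?thesis
        using that by simp
    qed
    show "1 / ((1 + real k) * (1 + real (m - k))) = (1 / (1 + real k) + 1 / (1 + real (m - k))) / (2 + real m)"
      unfolding m by (rule pf) auto
  qed
  also have "\<dots> = 2 * (\<Sum>k\<le>m. 1 / (1 + real k)) / (2 + real m)"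
    using sum_rev_atMost[of "\<lambda>k. 1 / (1 + real k)" m]
    by (simp add: sum.distrib flip: sum_divide_distrib)
  \<comment> \<open>The harmonic sum is bounded crudely by the sum of inverse square roots. The
    resulting factor \<open>sqrt (1 + real m)\<close>, multiplied by the target weight, is still
    absorbed by the denominator.\<close>
  also have "\<dots> \<le> 2 * (\<Sum>k\<le>m. 1 / sqrt (1 + real k)) / (2 + real m)"
    by (intro divide_right_mono mult_left_mono sum_mono divide_left_mono) (auto intro!: real_le_lsqrt self_le_power)
  also have "\<dots> \<le> 2 * (2 * sqrt (1 + real m)) / (2 + real m)"
    by (intro divide_right_mono mult_left_mono sum_inverse_sqrt_le) auto
  finally have "sqrt (1 + real m) * (\<Sum>k\<le>m. 1 / ((1 + real k) * (1 + real (m - k))))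
      \<le> sqrt (1 + real m) * (2 * (2 * sqrt (1 + real m)) / (2 + real m))"
    by (intro mult_left_mono) auto
  also have "\<dots> = 4 * (sqrt (1 + real m) * sqrt (1 + real m)) / (2 + real m)"
    by (simp only: times_divide_eq_right mult.left_commute)
  also have "\<dots> = 4 * (1 + real m) / (2 + real m)"
    by (subst real_sqrt_mult_self) simp
  also have "\<dots> \<le> 4"
    by (simp add: field_simps)
  finally show "weight TYPE(w_quarter) m * (\<Sum>k\<le>m. 1 / (weight TYPE(w_half) k * weight TYPE(w_half) (m - k))) \<le> 4"
    by (simp add: weight_simps)
qed simp

global_interpretation EHQ: emb_weights "TYPE(w_half)" "TYPE(w_quarter)"
proof
  fix m
  have "sqrt (1 + real m) \<le> sqrt ((1 + real m)\<^sup>2)"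
    by (intro real_sqrt_le_mono) (simp add: power2_eq_square algebra_simps)
  then show "weight TYPE(w_quarter) m \<le> weight TYPE(w_half) m"
    by (simp add: weight_simps)
qed

global_interpretation EQ0: emb_weights "TYPE(w_quarter)" "TYPE(w_zero)"
  by standard (simp add: weight_simps)

global_interpretation EH0: emb_weights "TYPE(w_half)" "TYPE(w_zero)"
  by standard (simp add: weight_simps)

interpretation Hbil: bounded_bilinear "hank :: half \<Rightarrow> 'w::hankel_weight wl2 \<Rightarrow> 'w wl2"
  by (rule H.bounded_bilinear_hank)
interpretation HQbil: bounded_bilinear "hank :: quarter \<Rightarrow> quarter \<Rightarrow> ell2"
  by (rule HQ.bounded_bilinear_hank)
interpretation CQbil: bounded_bilinear "prodw :: quarter \<Rightarrow> quarter \<Rightarrow> ell2"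
  by (rule CQ.bounded_bilinear_prodw)
interpretation CHbil: bounded_bilinear "prodw :: half \<Rightarrow> half \<Rightarrow> quarter"
  by (rule CH.bounded_bilinear_prodw)

section \<open>The basic operators\<close>

text \<open>Complex scalar multiplication is a separate operation because the vector space structure
  is only real.\<close>

definition cscale :: "complex \<Rightarrow> 'w::weight wl2 \<Rightarrow> 'w wl2" where
  "cscale c x = Abs_wl2 (\<lambda>k. c * cf x k)"

lemma cf_cscale [simp]: "cf (cscale c x) k = c * cf x k"
  unfolding cscale_def by (subst cf_Abs[OF summable_weight_cmult]) simp

lemma norm_cscale: "norm (cscale c x) = cmod c * norm x" for x :: "'w::weight wl2"
proof -
  have "(norm (cscale c x))\<^sup>2 = (cmod c)\<^sup>2 * (norm x)\<^sup>2"
    unfolding norm_wl2_sq suminf_mult[OF summable_cf, symmetric]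
    by (simp add: norm_mult power_mult_distrib mult_ac)
  then have "(norm (cscale c x))\<^sup>2 = (cmod c * norm x)\<^sup>2"
    by (simp add: power_mult_distrib)
  then show ?thesis
    by (rule power2_eq_imp_eq) auto
qed

lemma bounded_linear_cscale: "bounded_linear (cscale c)"
  by (rule bounded_linear_intro[where K = "cmod c"]) (auto intro!: wl2_eqI simp: ring_distribs norm_cscale mult_ac)

lemma bounded_linear_left_shift: "bounded_linear (\<lambda>x :: 'w::weight wl2. Abs_wl2 (shift_adj (cf x)) :: 'w wl2)"
  and cf_left_shift: "cf (Abs_wl2 (shift_adj (cf x)) :: 'w wl2) = shift_adj (cf x)" for x :: "'w::weight wl2"
proof -
  have bd: "(\<Sum>k<n. weight TYPE('w) k * (cmod (shift_adj (cf x) k))\<^sup>2) \<le> (norm x)\<^sup>2" for x :: "'w wl2" and n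
  proof -
    have "(\<Sum>k<n. weight TYPE('w) k * (cmod (shift_adj (cf x) k))\<^sup>2)
        \<le> (\<Sum>k<n. weight TYPE('w) (Suc k) * (cmod (cf x (Suc k)))\<^sup>2)"
      by (intro sum_mono) (auto simp: shift_adj_def weight_le_Suc mult_right_mono)
    also have "\<dots> \<le> (\<Sum>k<Suc n. weight TYPE('w) k * (cmod (cf x k))\<^sup>2)"
      unfolding sum.lessThan_Suc_shift by simp
    also have "\<dots> \<le> (norm x)\<^sup>2"
      by (rule sum_weight_le_norm)
    finally show ?thesis .
  qed
  show cfs: "cf (Abs_wl2 (shift_adj (cf x)) :: 'w wl2) = shift_adj (cf x)" for x :: "'w wl2"
    by (rule cf_Abs[OF wl2_boundedI(1)[OF bd]])
  have "norm (Abs_wl2 (shift_adj (cf x)) :: 'w wl2) \<le> norm x" for x :: "'w wl2"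
    using wl2_boundedI(2)[OF bd] by (rule power2_le_imp_le) simp
  then show "bounded_linear (\<lambda>x :: 'w wl2. Abs_wl2 (shift_adj (cf x)) :: 'w wl2)"
    by (intro bounded_linear_intro[where K = 1]) (auto intro!: wl2_eqI simp: cfs shift_adj_def)
qed

lemma bounded_linear_right_shift: "bounded_linear (\<lambda>x :: 'w::weight wl2. Abs_wl2 (shift (cf x)) :: 'w wl2)"
  and cf_right_shift: "cf (Abs_wl2 (shift (cf x)) :: 'w wl2) = shift (cf x)" for x :: "'w::weight wl2"
proof -
  have bd: "(\<Sum>k<n. weight TYPE('w) k * (cmod (shift (cf x) k))\<^sup>2) \<le> 2 * (norm x)\<^sup>2" for x :: "'w wl2" and n
  proof -
    have "(\<Sum>k<n. weight TYPE('w) k * (cmod (shift (cf x) k))\<^sup>2)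
        \<le> (\<Sum>k<Suc n. weight TYPE('w) k * (cmod (shift (cf x) k))\<^sup>2)"
      by simp
    also have "\<dots> = (\<Sum>k<n. weight TYPE('w) (Suc k) * (cmod (cf x k))\<^sup>2)"
      by (subst sum.lessThan_Suc_shift) (simp add: shift_def)
    also have "\<dots> \<le> (\<Sum>k<n. 2 * (weight TYPE('w) k * (cmod (cf x k))\<^sup>2))"
      unfolding mult.assoc[symmetric] by (intro sum_mono mult_right_mono weight_Suc_le) auto
    also have "\<dots> \<le> 2 * (norm x)\<^sup>2"
      unfolding sum_distrib_left[symmetric] by (intro mult_left_mono sum_weight_le_norm) simp
    finally show ?thesis .
  qed
  show cfs: "cf (Abs_wl2 (shift (cf x)) :: 'w wl2) = shift (cf x)" for x :: "'w wl2"
    by (rule cf_Abs[OF wl2_boundedI(1)[OF bd]])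
  have "norm (Abs_wl2 (shift (cf x)) :: 'w wl2) \<le> norm x * sqrt 2" for x :: "'w wl2"
    by (rule power2_le_imp_le) (use wl2_boundedI(2)[OF bd[where x = x]] in \<open>auto simp: power_mult_distrib mult_ac\<close>)
  then show "bounded_linear (\<lambda>x :: 'w wl2. Abs_wl2 (shift (cf x)) :: 'w wl2)"
    by (intro bounded_linear_intro[where K = "sqrt 2"]) (auto intro!: wl2_eqI simp: cfs shift_def)
qed

abbreviation hk :: "half \<Rightarrow> 'w::hankel_weight wl2 \<Rightarrow> 'w wl2" where
  "hk \<equiv> hank"

text \<open>Operators are only real-linear, so that the antilinear \<open>H\<^sub>u\<close> belongs to the same algebra
  as the shifts; multiplication by \<open>\<i>\<close> is the element \<open>Jop\<close>.\<close>
definition Jop :: "'w::weight wl2 endo" where "Jop = mk_endo (cscale \<i>)"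
definition Lop :: "'w::weight wl2 endo" where "Lop = mk_endo (\<lambda>x. Abs_wl2 (shift_adj (cf x)))"
definition Rop :: "'w::weight wl2 endo" where "Rop = mk_endo (\<lambda>x. Abs_wl2 (shift (cf x)))"
definition Hop :: "half \<Rightarrow> 'w::hankel_weight wl2 endo" where "Hop a = mk_endo (hank a)"

lemma app_Jop [simp]: "app Jop x = cscale \<i> x"
  by (simp add: Jop_def app_mk_endo bounded_linear_cscale)

lemma cf_Lop [simp]: "cf (app Lop x) k = cf x (Suc k)"
  by (simp add: Lop_def app_mk_endo[OF bounded_linear_left_shift] cf_left_shift shift_adj_def)

lemma cf_Rop: "cf (app Rop x) = shift (cf x)"
  by (simp add: Rop_def app_mk_endo[OF bounded_linear_right_shift] cf_right_shift)

lemma app_Hop: "app (Hop a) x = hk a x"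
  by (simp add: Hop_def app_mk_endo[OF Hbil.bounded_linear_right])

lemma cf_Hop: "cf (app (Hop a) x) = hankel (cf a) (cf x)"
  by (simp add: app_Hop H.cf_hank)

text \<open>This turns continuity of a curve in H^{1/2} into norm continuity of its Hankel
  operators.\<close>

lemma bounded_linear_Hop: "bounded_linear (Hop :: half \<Rightarrow> 'w::hankel_weight wl2 endo)"
proof (rule bounded_linear_intro[where K = "sqrt 2"])
  fix a b :: half and r :: real
  show "Hop (a + b) = (Hop a + Hop b :: 'w wl2 endo)"
    by (rule endo_eqI) (simp add: app_Hop Hbil.add_left app.add_left)
  show "Hop (scaleR r a) = (scaleR r (Hop a) :: 'w wl2 endo)"
    by (rule endo_eqI) (simp add: app_Hop Hbil.scaleR_left app.scaleR_left)
  show "norm (Hop a :: 'w wl2 endo) \<le> norm a * sqrt 2"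
  proof (rule norm_endo_bound)
    show "norm (app (Hop a) x) \<le> norm a * sqrt 2 * norm x" for x :: "'w wl2"
      using H.norm_hank_le[of a x] by (simp add: app_Hop mult_ac)
  qed simp
qed

lemma Lop_power: "cf (app (Lop ^ n) x) k = cf x (n + k)"
  by (induction n arbitrary: x k) (auto simp: power_Suc2 simp del: power_Suc)

lemma hankel_single: "hankel a (cf (single q c :: 'w::weight wl2)) n = a (n + q) * cnj c"
proof -
  have "hankel a (cf (single q c :: 'w wl2)) n = (\<Sum>k. if k = q then a (n + k) * cnj c else 0)"
    unfolding hankel_def by (intro suminf_cong) auto
  also have "\<dots> = a (n + q) * cnj c"
    by (rule sums_unique[symmetric, OF sums_single])
  finally show ?thesis .
qed

lemma conv_commute: "conv a b = conv b a"
proof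
  fix n
  have "conv a b n = (\<Sum>j\<le>n. a (n - j) * b (n - (n - j)))"
    unfolding conv_def by (rule sum_rev_atMost[symmetric])
  also have "\<dots> = conv b a n"
    unfolding conv_def by (intro sum.cong) (auto simp: mult.commute)
  finally show "conv a b n = conv b a n" .
qed

lemma conv_single: "conv a (cf (single p c :: 'w::weight wl2)) n = (if p \<le> n then a (n - p) * c else 0)"
proof -
  have "conv a (cf (single p c :: 'w wl2)) n = (\<Sum>j\<le>n. if j = n - p \<and> p \<le> n then a (n - p) * c else 0)"
    unfolding conv_def by (intro sum.cong) auto
  also have "\<dots> = (if p \<le> n then a (n - p) * c else 0)"
    by auto
  finally show ?thesis .
qed

text \<open>Expand one argument at a time in monomials. The coefficients are complex because the
  maps are only real-bilinear.\<close>

lemma bounded_bilinear_ext_wl2: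
  fixes B B' :: "'u::weight wl2 \<Rightarrow> 'v::weight wl2 \<Rightarrow> 'z::real_normed_vector"
  assumes B: "bounded_bilinear B" and B': "bounded_bilinear B'"
    and eq: "\<And>q c p d. B (single q c) (single p d) = B' (single q c) (single p d)"
  shows "B f g = B' f g"
proof -
  have *: "A x = A' x" if "bounded_linear A" "bounded_linear A'" "\<And>q c. A (single q c) = A' (single q c)"
    for x :: "'t::weight wl2" and A A' :: "'t wl2 \<Rightarrow> 'z"
  proof -
    have "(\<lambda>k. A (single k (cf x k))) sums A x"
      using bounded_linear.sums[OF that(1) sums_single_wl2] .
    moreover have "(\<lambda>k. A' (single k (cf x k))) sums A' x"
      using bounded_linear.sums[OF that(2) sums_single_wl2] .
    ultimately show ?thesis
      unfolding that(3) by (rule sums_unique2)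
  qed
  have "B (single q c) g = B' (single q c) g" for q c
    by (rule *) (rule bounded_bilinear.bounded_linear_right[OF B] bounded_bilinear.bounded_linear_right[OF B'] eq)+
  then show ?thesis
    using *[OF bounded_bilinear.bounded_linear_left[OF B] bounded_bilinear.bounded_linear_left[OF B'], of g g f] by blast
qed

lemma Lop_Jop: "Lop * Jop = Jop * Lop"
  by (rule endo_eqI, rule wl2_eqI) simp

lemma Rop_Jop: "Rop * Jop = Jop * Rop"
  by (rule endo_eqI, rule wl2_eqI) (simp add: cf_Rop shift_def)

lemma Lop_Rop: "Lop * Rop = 1"
  by (rule endo_eqI, rule wl2_eqI) (simp add: cf_Rop shift_def)

lemma cscale_hank: "hk a (cscale c f) = cscale (cnj c) (hk a f)" for a :: half and f :: "'w::hankel_weight wl2"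
  by (rule wl2_eqI) (simp add: H.cf_hank hankel_def suminf_mult[OF H.summable_hank, symmetric] mult.left_commute)

lemma Hop_Jop: "Hop a * Jop = - (Jop * Hop a)"
  by (rule endo_eqI, rule wl2_eqI) (simp add: app.minus_left app_Hop cscale_hank)

text \<open>The entries of a Hankel matrix depend on \<open>n + k\<close> alone. This identifies the
  two descriptions of \<open>K_u\<close>.\<close>

lemma Lop_Hop: "Lop * Hop a = Hop a * Rop"
proof (rule endo_eqI, rule wl2_eqI)
  fix x :: "'a wl2" and n
  have "hankel (cf a) (cf (app Rop x)) n = (\<Sum>k. cf a (n + k) * cnj (cf (app Rop x) k))"
    by (simp add: hankel_def)
  \<comment> \<open>The term for \<open>k = 0\<close> drops out, as the shift inserts a zero
    there.\<close>
  also have "\<dots> = (\<Sum>k. cf a (n + Suc k) * cnj (cf (app Rop x) (Suc k)))"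
    using suminf_split_initial_segment[OF H.summable_hank[of a n "app Rop x"], of 1]
    by (simp add: cf_Rop shift_def)
  also have "\<dots> = hankel (cf a) (cf x) (Suc n)"
    by (simp add: hankel_def cf_Rop shift_def)
  finally show "cf (app (Lop * Hop a) x) n = cf (app (Hop a * Rop) x) n"
    by (simp add: cf_Hop)
qed


section \<open>The pairing of quarter spaces\<close>

lemma inner_ell2: "inner x y = (\<Sum>k. Re (cf x k * cnj (cf y k)))" for x y :: ell2
  by (simp add: inner_wl2_def weight_simps)

lemma inner_ell2_single: "inner x (single n c) = Re (cf x n * cnj c)" for x :: ell2
proof -
  have "inner x (single n c) = (\<Sum>k. if k = n then Re (cf x k * cnj c) else 0)"
    unfolding inner_ell2 by (intro suminf_cong) auto
  also have "\<dots> = Re (cf x n * cnj c)"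
    by (rule sums_unique[symmetric, OF sums_single])
  finally show ?thesis .
qed

lemma inner_ell2_ext:
  fixes x y x' y' :: ell2
  assumes "\<And>k. cf x k * cnj (cf y k) = cf x' k * cnj (cf y' k)"
  shows "inner x y = inner x' y'"
  unfolding inner_ell2 assms by (rule refl)

lemma inner_cscale_left: "inner (cscale c x) y = inner x (cscale (cnj c) y)" for x y :: ell2
  by (rule inner_ell2_ext) simp

lemma inner_Rop: "inner x (app Rop y) = inner (app Lop x) y" for x y :: ell2
proof -
  have "inner x (app Rop y) = (\<Sum>k. Re (cf x (Suc k) * cnj (cf (app Rop y) (Suc k))))"
    using suminf_split_initial_segment[OF summable_inner[of x "app Rop y"], of 1]
    by (simp add: inner_ell2 cf_Rop shift_def weight_simps)
  then show ?thesis
    by (simp add: inner_ell2 cf_Rop shift_def)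
qed

lemma inner_Rop_Rop: "inner (app Rop x) (app Rop y) = inner x y" for x y :: ell2
  unfolding inner_Rop using arg_cong[OF Lop_Rop, of "\<lambda>A. app A x"] by simp

lemma inner_Rop_power: "inner x (app (Rop ^ n) y) = inner (app (Lop ^ n) x) y" for x y :: ell2
proof (induction n arbitrary: x)
  case (Suc n)
  then show ?case
    by (simp only: power_Suc[of Rop] power_Suc2[of Lop] app_mult inner_Rop)
qed simp

lemma Rop_cscale: "app Rop (cscale c x) = cscale c (app Rop x)"
  by (rule wl2_eqI) (simp add: cf_Rop shift_def)

lemma Lop_cscale: "app (Lop ^ n) (cscale c x) = cscale c (app (Lop ^ n) x)"
  by (rule wl2_eqI) (simp add: Lop_power)

text \<open>Adjoints on \<open>quarter\<close> are taken with respect to this L2 pairing and not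
  with respect to the inner product of \<open>quarter\<close>.\<close>

definition pr :: "quarter \<Rightarrow> quarter \<Rightarrow> real" where
  "pr f g = inner (emb f :: ell2) (emb g)"

lemma bounded_bilinear_pr: "bounded_bilinear pr"
  unfolding pr_def
  using bounded_bilinear.comp[OF bounded_bilinear_inner EQ0.bounded_linear_emb EQ0.bounded_linear_emb] .

interpretation pr: bounded_bilinear pr
  by (rule bounded_bilinear_pr)

lemma pr_commute: "pr f g = pr g f"
  by (simp add: pr_def inner_commute)

lemma pr_Jop: "pr (app Jop f) g = - pr f (app Jop g)"
proof -
  have "pr (app Jop f) g = inner (emb f :: ell2) (emb (- app Jop g))"
    unfolding pr_def by (rule inner_ell2_ext) (simp add: EQ0.cf_emb)
  also have "\<dots> = pr f (- app Jop g)"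
    by (simp add: pr_def)
  finally show ?thesis
    by (simp only: pr.minus_right)
qed

lemma emb_Lop: "emb (app Lop f) = (app Lop (emb f) :: ell2)" for f :: quarter
  by (rule wl2_eqI) (simp add: EQ0.cf_emb)

lemma emb_Rop: "emb (app Rop f) = (app Rop (emb f) :: ell2)" for f :: quarter
  by (rule wl2_eqI) (simp add: EQ0.cf_emb cf_Rop shift_def)

lemma pr_Lop: "pr (app Lop f) g = pr f (app Rop g)"
  by (simp add: pr_def emb_Lop emb_Rop inner_Rop)

abbreviation cmul :: "quarter \<Rightarrow> quarter \<Rightarrow> ell2" where
  "cmul \<equiv> prodw"

lemma cmul_commute: "cmul f g = cmul g f"
  by (rule wl2_eqI) (simp add: CQ.cf_prodw conv_commute)

lemma cmul_cscale: "cmul (cscale c f) g = cscale c (cmul f g)" "cmul f (cscale c g) = cscale c (cmul f g)"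
  by (rule wl2_eqI; simp add: CQ.cf_prodw conv_def sum_distrib_left mult_ac)+

lemma cmul_Rop: "cmul f (app Rop g) = app Rop (cmul f g)"
proof (rule wl2_eqI)
  fix k
  show "cf (cmul f (app Rop g)) k = cf (app Rop (cmul f g)) k"
    by (cases k) (auto simp: CQ.cf_prodw cf_Rop conv_def shift_def Suc_diff_le intro!: sum.cong)
qed

lemma bounded_linear_comp_bilinear:
  assumes T: "bounded_linear T" and B: "bounded_bilinear B"
  shows "bounded_bilinear (\<lambda>x y. T (B x y))"
proof -
  interpret T: bounded_linear T by fact
  interpret B: bounded_bilinear B by fact
  obtain K where K: "\<And>x. norm (T x) \<le> norm x * K" "0 < K"
    using T.pos_bounded by blast
  obtain M where M: "\<And>x y. norm (B x y) \<le> norm x * norm y * M"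
    using B.bounded by blast
  show ?thesis
  proof
    have "norm (T (B x y)) \<le> norm x * norm y * (M * K)" for x y
    proof -
      have "norm (T (B x y)) \<le> norm (B x y) * K"
        by (rule K)
      also have "\<dots> \<le> norm x * norm y * M * K"
        using K(2) by (intro mult_right_mono M) simp
      finally show ?thesis
        by (simp add: mult.assoc)
    qed
    then show "\<exists>K. \<forall>x y. norm (T (B x y)) \<le> norm x * norm y * K"
      by blast
  qed (simp_all add: B.add_left B.add_right B.scaleR_left B.scaleR_right T.add T.scaleR)
qed

lemma bounded_bilinear_plus:
  assumes A: "bounded_bilinear A" and B: "bounded_bilinear B"
  shows "bounded_bilinear (\<lambda>x y. A x y + B x y)"
proof -
  interpret A: bounded_bilinear A by fact
  interpret B: bounded_bilinear B by fact
  obtain K M where K: "\<And>x y. norm (A x y) \<le> norm x * norm y * K"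
    and M: "\<And>x y. norm (B x y) \<le> norm x * norm y * M"
    using A.bounded B.bounded by blast
  show ?thesis
  proof
    have "norm (A x y + B x y) \<le> norm x * norm y * (K + M)" for x y
      using norm_triangle_mono[OF K M] by (simp add: distrib_left)
    then show "\<exists>K. \<forall>x y. norm (A x y + B x y) \<le> norm x * norm y * K"
      by blast
  qed (simp_all add: A.add_left A.add_right A.scaleR_left A.scaleR_right
        B.add_left B.add_right B.scaleR_left B.scaleR_right scaleR_add_right)
qed

text \<open>On monomials of degrees \<open>q\<close> and \<open>p\<close> both sides reduce to the
  coefficient of \<open>a\<close> at \<open>p + q\<close>. Commutativity of the product then makes
  the Hankel operator symmetric.\<close>

lemma pr_hank: "pr (hk a f) g = inner (emb a) (cmul f g)" for a :: half
proof (rule bounded_bilinear_ext_wl2[of "\<lambda>f g. pr (hk a f) g" "\<lambda>f g. inner (emb a) (cmul f g)"])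
  show "bounded_bilinear (\<lambda>f. pr (hk a f))"
    by (rule pr.comp1[OF Hbil.bounded_linear_right])
  show "bounded_bilinear (\<lambda>f g. inner (emb a) (cmul f g))"
    by (rule bounded_linear_comp_bilinear[OF bounded_linear_inner_right CQ.bounded_bilinear_prodw])
  have "emb (hk a (single q c) :: quarter) = cscale (cnj c) (app (Lop ^ q) (emb a :: ell2))" for q c
    by (rule wl2_eqI) (simp add: EQ0.cf_emb H.cf_hank hankel_single Lop_power EH0.cf_emb add.commute)
  moreover have "emb (single p d :: quarter) = (single p d :: ell2)" for p d
    by (rule wl2_eqI) (simp add: EQ0.cf_emb)
  moreover have "cmul (single q c) (single p d) = single (p + q) (c * d)" for q c p d
    by (rule wl2_eqI) (auto simp: CQ.cf_prodw conv_single)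
  ultimately show "pr (hk a (single q c)) (single p d) = inner (emb a) (cmul (single q c) (single p d))" for q c p d
    by (simp add: pr_def inner_ell2_single Lop_power algebra_simps)
qed

lemma pr_Hop: "pr (app (Hop a) f) g = pr f (app (Hop a) g)"
  by (metis app_Hop pr_hank pr_commute cmul_commute)

subsection \<open>The quadratic form of the Toeplitz operator with symbol \<open>\<bar>u\<bar>\<^sup>2\<close>\<close>

text \<open>The real part of \<open>(T f | g)\<close>, written as \<open>(u f | u g)\<close>. It is
  finite because products of two elements of \<open>quarter\<close> lie in L2.\<close>

definition tau :: "half \<Rightarrow> quarter \<Rightarrow> quarter \<Rightarrow> real" where
  "tau u f g = inner (cmul (emb u) f) (cmul (emb u) g)"

lemma bounded_bilinear_tau: "bounded_bilinear (tau u)"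
  unfolding tau_def
  by (rule bounded_bilinear.comp[OF bounded_bilinear_inner CQbil.bounded_linear_right CQbil.bounded_linear_right])

lemma tau_commute: "tau u f g = tau u g f"
  by (simp add: tau_def inner_commute)

lemma decompose_shift: "cmul v f = app Rop (cmul v (app Lop f)) + cscale (cf f 0) (emb v)"
proof -
  have f: "f = app Rop (app Lop f) + single 0 (cf f 0)"
    by (rule wl2_eqI) (simp add: cf_Rop shift_def)
  have "cmul v f = app Rop (cmul v (app Lop f)) + cmul v (single 0 (cf f 0))"
    by (subst f) (simp only: CQbil.add_right cmul_Rop)
  also have "cmul v (single 0 (cf f 0)) = cscale (cf f 0) (emb v)"
    by (rule wl2_eqI) (simp add: CQ.cf_prodw conv_single EQ0.cf_emb mult.commute)
  finally show ?thesis .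
qed

lemma hank_single_0: "hk a (single 0 c) = cscale (cnj c) (emb a :: quarter)" for a :: half
  by (rule wl2_eqI) (simp add: H.cf_hank hankel_single EHQ.cf_emb mult.commute)

lemma emb_emb: "emb (emb u :: quarter) = (emb u :: ell2)" for u :: half
  by (rule wl2_eqI) (simp add: EQ0.cf_emb EHQ.cf_emb EH0.cf_emb)

text \<open>The weak form of the commutator of \<open>T\<close> with the adjoint shift. Split
  \<open>f\<close> into its constant term and a shifted function: the shift is an isometry, so only
  the constant term contributes to the defect.\<close>

lemma tau_shift:
  fixes u :: half
  defines "H \<equiv> Hop u" and "K \<equiv> Lop * Hop u"
  shows "tau u (app Lop f) g = tau u f (app Rop g) - pr (app (Lop * H * H - K * K * Lop) f) g"
proof -
  let ?u = "emb u :: quarter"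
  let ?e = "single 0 (cf f 0) :: quarter"
  \<comment> \<open>The last factor is the projection onto constants, so the operator sees only
    \<open>cf f 0\<close>.\<close>
  have "Lop * H * H - K * K * Lop = Lop * H * H * (1 - Rop * Lop)"
    unfolding K_def H_def by (simp add: algebra_simps Lop_Hop)
  then have "app (Lop * H * H - K * K * Lop) f = app (Lop * H * H) (f - app Rop (app Lop f))"
    by (simp add: app.diff_left)
  also have "f - app Rop (app Lop f) = ?e"
    by (rule wl2_eqI) (simp add: cf_Rop shift_def)
  finally have "pr (app (Lop * H * H - K * K * Lop) f) g = pr (app Lop (hk u (hk u ?e))) g"
    by (simp add: H_def app_Hop)
  also have "\<dots> = inner (emb u) (cmul (cscale (cnj (cf f 0)) ?u) (app Rop g))"
    by (simp add: pr_Lop pr_hank hank_single_0)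
  also have "\<dots> = inner (cscale (cf f 0) (emb u)) (app Rop (cmul ?u g))"
    by (simp add: cmul_cscale cmul_Rop Rop_cscale inner_cscale_left)
  finally have "pr (app (Lop * H * H - K * K * Lop) f) g = inner (cscale (cf f 0) (emb u)) (app Rop (cmul ?u g))" .
  then show ?thesis
    unfolding tau_def by (subst (2) decompose_shift) (simp add: cmul_Rop inner_add_left inner_Rop_Rop emb_emb)
qed

subsection \<open>The nonlinearity\<close>

text \<open>The projection of \<open>u^2 conj u\<close> is the Hankel operator of symbol
  \<open>u^2\<close> applied to \<open>u\<close>. The square lies in \<open>quarter\<close>, and the
  result lies in L2.\<close>

definition nonlin :: "half \<Rightarrow> ell2" where
  "nonlin u = hank (prodw u u :: quarter) (emb u :: quarter)"

lemma cf_nonlin: "cf (nonlin u) n = szego_nl (cf u) n"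
  by (simp add: nonlin_def HQ.cf_hank EHQ.cf_emb CH.cf_prodw hankel_def szego_nl_def conv_def mult.commute)

lemma hankel_inner_single:
  fixes x :: quarter and u :: half
  shows "inner (hank x (emb u :: quarter) :: ell2) (single n c) = inner (app (Lop ^ n) (emb x)) (cscale c (emb u :: ell2))"
proof -
  have "inner (hank x (emb u :: quarter) :: ell2) (single n c) = Re ((\<Sum>k. cf x (n + k) * cnj (cf u k)) * cnj c)"
    by (simp add: inner_ell2_single HQ.cf_hank hankel_def EHQ.cf_emb del: times_complex.sel)
  also have "\<dots> = Re (\<Sum>k. cf x (n + k) * cnj (cf u k) * cnj c)"
    using suminf_mult2[OF HQ.summable_hank[of x n "emb u"], of "cnj c"] by (simp add: EHQ.cf_emb)
  also have "\<dots> = (\<Sum>k. Re (cf x (n + k) * cnj (cf u k) * cnj c))"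
    using HQ.summable_hank[of x n "emb u"]
    by (intro bounded_linear.suminf[OF bounded_linear_Re] summable_mult2) (simp add: EHQ.cf_emb)
  also have "\<dots> = inner (app (Lop ^ n) (emb x)) (cscale c (emb u :: ell2))"
    by (simp add: inner_ell2 Lop_power EQ0.cf_emb EH0.cf_emb mult_ac del: times_complex.sel)
  finally show ?thesis .
qed

text \<open>Inclusion-exclusion: since \<open>j + (n - j) = p + q + k\<close>, either \<open>j \<ge> q\<close> or \<open>n - j \<ge> p\<close>.\<close>
lemma conv_inclusion_exclusion:
  fixes a :: seq
  shows "conv a a (p + q + k) = conv a (\<lambda>m. a (q + m)) (p + k) + conv a (\<lambda>m. a (p + m)) (q + k)
     - conv (\<lambda>m. a (q + m)) (\<lambda>m. a (p + m)) k"
proof -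
  define F where "F j = a j * a (p + q + k - j)" for j
  have 1: "conv a (\<lambda>m. a (q + m)) (p + k) = sum F {q..p + q + k}"
    unfolding conv_commute[of a] conv_def
    by (rule sum.reindex_bij_witness[of _ "\<lambda>j. j - q" "\<lambda>j. j + q"]) (auto simp: F_def intro!: arg_cong[of _ _ a])
  have 2: "conv a (\<lambda>m. a (p + m)) (q + k) = sum F {0..q + k}"
    unfolding conv_def F_def by (intro sum.cong) (auto intro!: arg_cong[of _ _ a])
  have 3: "conv (\<lambda>m. a (q + m)) (\<lambda>m. a (p + m)) k = sum F {q..q + k}"
    unfolding conv_def
    by (rule sum.reindex_bij_witness[of _ "\<lambda>j. j - q" "\<lambda>j. j + q"]) (auto simp: F_def intro!: arg_cong[of _ _ a])
  have "conv a a (p + q + k) = sum F {0..p + q + k}"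
    by (simp add: conv_def F_def atMost_atLeast0)
  also have "\<dots> = sum F ({0..q + k} \<union> {q..p + q + k})"
    by (intro sum.cong) auto
  also have "\<dots> = sum F {0..q + k} + sum F {q..p + q + k} - sum F ({0..q + k} \<inter> {q..p + q + k})"
    by (subst sum.union_inter[of "{0..q + k}" "{q..p + q + k}", symmetric]) auto
  also have "{0..q + k} \<inter> {q..p + q + k} = {q..q + k}"
    by auto
  finally show ?thesis
    using 1 2 3 by simp
qed

text \<open>The weak form of \<open>H_N = T H_u + H_u T - H_u^3\<close>, where \<open>N\<close> is
  the nonlinearity. Tested on monomials, it is the inclusion-exclusion identity for
  convolutions.\<close>

lemma nonlin_identity:
  "inner (nonlin u) (cmul f g) = tau u (hk u f) g + tau u f (hk u g) - inner (emb u) (cmul (hk u f) (hk u g))"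
  (is "?B1 f g = ?B2 f g")
proof (rule bounded_bilinear_ext_wl2[of ?B1 ?B2])
  interpret t: bounded_bilinear "tau u"
    by (rule bounded_bilinear_tau)
  show "bounded_bilinear ?B1"
    by (rule bounded_linear_comp_bilinear[OF bounded_linear_inner_right CQ.bounded_bilinear_prodw])
  have 3: "bounded_bilinear (\<lambda>f g. inner (emb u) (cmul (hk u f) (hk u g)))"
    by (intro bounded_linear_comp_bilinear[OF bounded_linear_inner_right]
       CQbil.comp Hbil.bounded_linear_right)
  show "bounded_bilinear ?B2"
    unfolding diff_conv_add_uminus
    by (intro bounded_bilinear_plus bounded_linear_comp_bilinear[OF bounded_linear_minus[OF bounded_linear_ident]]
        3 t.comp Hbil.bounded_linear_right bounded_linear_ident)
  fix q p :: nat and c d :: complex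
  let ?f = "single q c :: quarter" and ?g = "single p d :: quarter"
  let ?u = "emb u :: quarter" and ?w = "cscale (c * d) (emb u :: ell2)"
  \<comment> \<open>On monomials the Hankel operator gives adjoint shifts of \<open>u\<close>, and
    multiplication by \<open>u\<close> gives shifts. Every term thereby becomes a pairing with the
    same vector \<open>?w\<close>.\<close>
  have hs: "hk u (single q c :: quarter) = cscale (cnj c) (app (Lop ^ q) ?u)" for q c
    by (rule wl2_eqI) (simp add: H.cf_hank hankel_single EHQ.cf_emb Lop_power add.commute)
  have ms: "cmul ?u (single p d) = app (Rop ^ p) (cscale d (emb u))" for p d
  proof (induction p)
    case 0
    then show ?case
      by (intro wl2_eqI) (simp add: CQ.cf_prodw conv_single EHQ.cf_emb EH0.cf_emb)
  next
    case (Suc p)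
    have "(single (Suc p) d :: quarter) = app Rop (single p d)"
      by (rule wl2_eqI) (auto simp: cf_Rop shift_def)
    then show ?case
      using Suc by (simp add: cmul_Rop)
  qed
  have N: "?B1 ?f ?g = inner (app (Lop ^ (p + q)) (cmul ?u ?u)) ?w"
  proof -
    have "cmul ?f ?g = single (p + q) (c * d)"
      by (rule wl2_eqI) (auto simp: CQ.cf_prodw conv_single)
    moreover have "emb (prodw u u :: quarter) = cmul ?u ?u"
      by (rule wl2_eqI) (simp add: EQ0.cf_emb CH.cf_prodw CQ.cf_prodw EHQ.cf_emb)
    ultimately show ?thesis
      by (simp add: nonlin_def hankel_inner_single)
  qed
  have T: "tau u (hk u (single q c)) (single p d) = inner (app (Lop ^ p) (cmul ?u (app (Lop ^ q) ?u))) (cscale (c * d) (emb u))"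
    for p q c d
    unfolding tau_def hs ms inner_Rop_power cmul_cscale Lop_cscale
    by (rule inner_ell2_ext) (simp add: mult_ac)
  have D: "inner (emb u) (cmul (hk u ?f) (hk u ?g)) = inner (cmul (app (Lop ^ q) ?u) (app (Lop ^ p) ?u)) ?w"
  proof -
    have "inner (emb u) (cmul (hk u ?f) (hk u ?g)) = inner (cmul (hk u ?f) (hk u ?g)) (emb u)"
      by (rule inner_commute)
    also have "\<dots> = inner (cmul (app (Lop ^ q) ?u) (app (Lop ^ p) ?u)) ?w"
      unfolding hs cmul_cscale by (rule inner_ell2_ext) (simp add: mult_ac)
    finally show ?thesis .
  qed
  have "app (Lop ^ (p + q)) (cmul ?u ?u) = app (Lop ^ p) (cmul ?u (app (Lop ^ q) ?u))
      + app (Lop ^ q) (cmul ?u (app (Lop ^ p) ?u)) - cmul (app (Lop ^ q) ?u) (app (Lop ^ p) ?u)"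
  proof (rule wl2_eqI)
    have L: "cf (app (Lop ^ n) ?u) = (\<lambda>m. cf u (n + m))" for n
      by (rule ext) (simp add: Lop_power EHQ.cf_emb)
    show "cf (app (Lop ^ (p + q)) (cmul ?u ?u)) k = cf (app (Lop ^ p) (cmul ?u (app (Lop ^ q) ?u))
      + app (Lop ^ q) (cmul ?u (app (Lop ^ p) ?u)) - cmul (app (Lop ^ q) ?u) (app (Lop ^ p) ?u)) k" for k
      by (simp add: Lop_power CQ.cf_prodw L EHQ.cf_emb conv_inclusion_exclusion)
  qed
  then show "?B1 ?f ?g = ?B2 ?f ?g"
    unfolding tau_commute[of u "single q c"] N T D mult.commute[of d c]
    by (simp add: inner_add_left inner_diff_left)
qed

section \<open>Evolution of words in the Lax operators\<close>

text \<open>The weak form of \<open>T 1 = H_u^2 1\<close>: a constant \<open>d\<close> satisfies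
  \<open>H_u d = cnj d * u\<close>, so moving one Hankel operator across the pairing produces
  \<open>(u f | d u)\<close>.\<close>

lemma tau_single_0: "tau u f (single 0 d) = pr (hk u (hk u f)) (single 0 d)"
proof -
  have "pr (hk u (hk u f)) (single 0 d) = pr (hk u f) (hk u (single 0 d))"
    using pr_Hop[of u "hk u f" "single 0 d"] by (simp add: app_Hop)
  also have "\<dots> = inner (cmul (emb u) f) (cscale d (emb u))"
    unfolding hank_single_0 pr_hank cmul_cscale cmul_commute[of f]
    by (subst inner_commute) (simp add: inner_cscale_left)
  also have "cscale d (emb u) = cmul (emb u) (single 0 d)"
    by (rule wl2_eqI) (simp add: CQ.cf_prodw conv_single EHQ.cf_emb EH0.cf_emb mult.commute)
  finally show ?thesis
    by (simp add: tau_def)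
qed

lemma pr_single_0: "pr f (single 0 d) = Re (cf f 0 * cnj d)"
proof -
  have "emb (single 0 d :: quarter) = (single 0 d :: ell2)"
    by (rule wl2_eqI) (simp add: EQ0.cf_emb)
  then show ?thesis
    by (simp add: pr_def inner_ell2_single EQ0.cf_emb)
qed

lemma hank_single_0_1: "hk a (single 0 1) = (emb a :: quarter)"
  unfolding hank_single_0 by (rule wl2_eqI) simp

section \<open>Weak Lax equations along a solution curve\<close>

lemma has_vector_derivative_quotient:
  assumes "(f has_vector_derivative D) (at t)"
  shows "((\<lambda>s. (f s - f t) /\<^sub>R (s - t)) \<longlongrightarrow> D) (at t)"
proof (rule LIM_zero_cancel, rule tendsto_norm_zero_cancel)
  have "((\<lambda>s. norm (f s - f t - (s - t) *\<^sub>R D) / norm (s - t)) \<longlongrightarrow> 0) (at t)"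
    using assms by (simp add: has_vector_derivative_def has_derivative_iff_norm)
  moreover have "eventually (\<lambda>s. norm (f s - f t - (s - t) *\<^sub>R D) / norm (s - t) = norm ((f s - f t) /\<^sub>R (s - t) - D)) (at t)"
  proof (rule eventually_mono[OF eventually_neq_at_within])
    fix s assume "s \<noteq> t"
    then have "(f s - f t) /\<^sub>R (s - t) - D = (f s - f t - (s - t) *\<^sub>R D) /\<^sub>R (s - t)"
      by (simp add: scaleR_diff_right)
    then show "norm (f s - f t - (s - t) *\<^sub>R D) / norm (s - t) = norm ((f s - f t) /\<^sub>R (s - t) - D)"
      by (simp only: norm_scaleR) (simp add: divide_inverse mult.commute)
  qed
  ultimately show "((\<lambda>s. norm ((f s - f t) /\<^sub>R (s - t) - D)) \<longlongrightarrow> 0) (at t)"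
    by (rule Lim_transform_eventually)
qed

text \<open>Continuity holds in H^{1/2} but the derivative is taken in L2, where
  \<open>nonlin\<close> has its values. This suffices because Hankel operators are tested against
  products of two elements of \<open>quarter\<close>, which are in L2.\<close>

locale szego_curve =
  fixes U :: "real \<Rightarrow> half"
  assumes U_cont: "isCont U t"
    and U_deriv: "((\<lambda>s. emb (U s) :: ell2) has_vector_derivative cscale (- \<i>) (nonlin (U t))) (at t)"
begin

text \<open>With \<open>A = - \<i> T\<close> for the unbounded Toeplitz operator \<open>T\<close> of symbol \<open>\<bar>u\<bar>\<^sup>2\<close>,
  the limit clause says \<open>Q' = [A, Q] + R\<close> in the sense of quadratic forms.\<close>
definition flow_with :: "(real \<Rightarrow> quarter endo) \<Rightarrow> (real \<Rightarrow> quarter endo) \<Rightarrow> (real \<Rightarrow> quarter endo) \<Rightarrow> bool" where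
  "flow_with Q Qd R \<longleftrightarrow>
    (\<forall>t. isCont Q t) \<and> (\<forall>t. isCont Qd t) \<and> (\<forall>t f g. pr (app (Q t) f) g = pr f (app (Qd t) g)) \<and>
    (\<forall>t F f G g. (F \<longlongrightarrow> f) (at t) \<longrightarrow> (G \<longlongrightarrow> g) (at t) \<longrightarrow>
      ((\<lambda>s. pr (app (Q s - Q t) (F s)) (G s) / (s - t)) \<longlongrightarrow>
        tau (U t) (app (Q t) f) (app Jop g) - tau (U t) f (app Jop (app (Qd t) g)) + pr (app (R t) f) g) (at t))"

text \<open>The product rule. The second factor at time \<open>s\<close> is absorbed into the left
  test function, and the adjoint of the first at time \<open>t\<close> into the right one, which is
  why \<open>flow_with\<close> admits moving test functions. The intermediate \<open>tau\<close>
  terms cancel.\<close>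

lemma flow_mult:
  assumes "flow_with Q1 Qd1 R1" "flow_with Q2 Qd2 R2"
  shows "flow_with (\<lambda>t. Q1 t * Q2 t) (\<lambda>t. Qd2 t * Qd1 t) (\<lambda>t. R1 t * Q2 t + Q1 t * R2 t)"
  unfolding flow_with_def
proof (intro conjI allI impI)
  fix t
  show "isCont (\<lambda>t. Q1 t * Q2 t) t" "isCont (\<lambda>t. Qd2 t * Qd1 t) t"
    using assms by (auto simp: flow_with_def intro!: isCont_mult)
  fix f g
  have adj: "pr (app (Q1 t) f) g = pr f (app (Qd1 t) g)" "pr (app (Q2 t) f) g = pr f (app (Qd2 t) g)" for f g
    using assms by (simp_all add: flow_with_def)
  show "pr (app (Q1 t * Q2 t) f) g = pr f (app (Qd2 t * Qd1 t) g)"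
    by (simp add: adj)
  fix F G
  assume F: "(F \<longlongrightarrow> f) (at t)" and G: "(G \<longlongrightarrow> g) (at t)"
  have Q2: "(Q2 \<longlongrightarrow> Q2 t) (at t)"
    using assms by (simp add: flow_with_def isCont_def)
  have "((\<lambda>s. app (Q2 s) (F s)) \<longlongrightarrow> app (Q2 t) f) (at t)"
    by (rule app.tendsto[OF Q2 F])
  then have 1: "((\<lambda>s. pr (app (Q1 s - Q1 t) (app (Q2 s) (F s))) (G s) / (s - t)) \<longlongrightarrow>
      tau (U t) (app (Q1 t) (app (Q2 t) f)) (app Jop g) - tau (U t) (app (Q2 t) f) (app Jop (app (Qd1 t) g))
      + pr (app (R1 t) (app (Q2 t) f)) g) (at t)"
    using assms(1) G unfolding flow_with_def by blast
  have "((\<lambda>s. app (Qd1 t) (G s)) \<longlongrightarrow> app (Qd1 t) g) (at t)"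
    by (rule app.tendsto[OF tendsto_const G])
  then have 2: "((\<lambda>s. pr (app (Q2 s - Q2 t) (F s)) (app (Qd1 t) (G s)) / (s - t)) \<longlongrightarrow>
      tau (U t) (app (Q2 t) f) (app Jop (app (Qd1 t) g)) - tau (U t) f (app Jop (app (Qd2 t) (app (Qd1 t) g)))
      + pr (app (R2 t) f) (app (Qd1 t) g)) (at t)"
    using assms(2) F unfolding flow_with_def by blast
  have eq: "pr (app (Q1 s * Q2 s - Q1 t * Q2 t) (F s)) (G s) / (s - t)
      = pr (app (Q1 s - Q1 t) (app (Q2 s) (F s))) (G s) / (s - t)
      + pr (app (Q2 s - Q2 t) (F s)) (app (Qd1 t) (G s)) / (s - t)" for s
    by (simp add: app.diff_left app.diff_right pr.diff_left adj[symmetric] diff_divide_distrib)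
  show "((\<lambda>s. pr (app (Q1 s * Q2 s - Q1 t * Q2 t) (F s)) (G s) / (s - t)) \<longlongrightarrow>
      tau (U t) (app (Q1 t * Q2 t) f) (app Jop g) - tau (U t) f (app Jop (app (Qd2 t * Qd1 t) g))
      + pr (app (R1 t * Q2 t + Q1 t * R2 t) f) g) (at t)"
    unfolding eq using tendsto_add[OF 1 2]
    by (simp add: app.add_left pr.add_left adj algebra_simps)
qed

definition flow :: "(real \<Rightarrow> quarter endo) \<Rightarrow> (real \<Rightarrow> quarter endo) \<Rightarrow> bool" where
  "flow Q R \<longleftrightarrow> (\<exists>Qd. flow_with Q Qd R)"

lemma flow_product:
  "flow Q1 R1 \<Longrightarrow> flow Q2 R2 \<Longrightarrow> (\<And>t. R t = R1 t * Q2 t + Q1 t * R2 t) \<Longrightarrow> flow (\<lambda>t. Q1 t * Q2 t) R"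
proof -
  assume "flow Q1 R1" "flow Q2 R2" and R: "\<And>t. R t = R1 t * Q2 t + Q1 t * R2 t"
  then obtain Qd1 Qd2 where "flow_with Q1 Qd1 R1" "flow_with Q2 Qd2 R2"
    by (auto simp: flow_def)
  moreover have "R = (\<lambda>t. R1 t * Q2 t + Q1 t * R2 t)"
    by (rule ext) (rule R)
  ultimately show ?thesis
    unfolding flow_def using flow_mult by blast
qed

lemma flow_one: "flow (\<lambda>t. 1) (\<lambda>t. 0)"
  unfolding flow_def flow_with_def by (intro exI[of _ "\<lambda>_. 1"]) (simp add: app.zero_left pr.zero_left del: app_Jop)

abbreviation "H \<equiv> \<lambda>t. Hop (U t) :: quarter endo"
abbreviation "K \<equiv> \<lambda>t. Lop * H t"

text \<open>The difference quotient of a constant is zero, so the remainder must cancel the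
  commutator with \<open>A\<close>, which \<open>tau_shift\<close> computes. The adjoint is
  \<open>Rop\<close>.\<close>

lemma flow_L: "flow (\<lambda>t. Lop) (\<lambda>t. - (Jop * (Lop * (H t * H t) - K t * K t * Lop)))"
proof -
  have "tau (U t) (app Lop f) (app Jop g) - tau (U t) f (app Jop (app Rop g))
      + pr (app (- (Jop * (Lop * (H t * H t) - K t * K t * Lop))) f) g = 0" for t f g
  proof -
    have "app Rop (app Jop g) = app Jop (app Rop g)"
      using arg_cong[OF Rop_Jop, of "\<lambda>A. app A g"] by simp
    moreover have "pr (app (- (Jop * (Lop * (H t * H t) - K t * K t * Lop))) f) g
        = pr (app (Lop * H t * H t - K t * K t * Lop) f) (app Jop g)"
      using pr_Jop[of "app (Lop * H t * H t - K t * K t * Lop) f" g]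
      by (simp add: app.minus_left pr.minus_left mult.assoc del: app_Jop)
    ultimately show ?thesis
      unfolding tau_shift by simp
  qed
  then show ?thesis
    unfolding flow_def flow_with_def
    by (intro exI[of _ "\<lambda>_. Rop"]) (simp add: pr_Lop app.zero_left pr.zero_left del: app_Jop)
qed

text \<open>Pairing the difference quotient of \<open>H\<close> amounts to pairing that of
  \<open>u\<close> with a product, so the L2 derivative applies. Antilinearity turns the
  anticommutator of \<open>nonlin_identity\<close> into a commutator with \<open>A\<close>, and the
  cubic term remains.\<close>

lemma flow_H: "flow H (\<lambda>t. Jop * H t * H t * H t)"
  unfolding flow_def flow_with_def
proof (intro exI[of _ H] conjI allI impI)
  show "isCont H t" "isCont H t" for t
    by (rule bounded_linear.isCont[OF bounded_linear_Hop U_cont])+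
  show "pr (app (H t) f) g = pr f (app (H t) g)" for t f g
    by (rule pr_Hop)
  fix t :: real and F G :: "real \<Rightarrow> quarter" and f g :: quarter
  assume F: "(F \<longlongrightarrow> f) (at t)" and G: "(G \<longlongrightarrow> g) (at t)"
  let ?u = "\<lambda>s. emb (U s) :: ell2"
  have "((\<lambda>s. (?u s - ?u t) /\<^sub>R (s - t)) \<longlongrightarrow> cscale (- \<i>) (nonlin (U t))) (at t)"
    by (rule has_vector_derivative_quotient[OF U_deriv])
  then have "((\<lambda>s. inner ((?u s - ?u t) /\<^sub>R (s - t)) (cmul (F s) (G s))) \<longlongrightarrow>
      inner (cscale (- \<i>) (nonlin (U t))) (cmul f g)) (at t)"
    by (intro tendsto_inner CQbil.tendsto F G)
  moreover have "inner ((?u s - ?u t) /\<^sub>R (s - t)) (cmul (F s) (G s)) = pr (app (H s - H t) (F s)) (G s) / (s - t)" for s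
    by (simp add: app.diff_left pr.diff_left app_Hop pr_hank inner_diff_left divide_inverse mult.commute)
  moreover have "inner (cscale (- \<i>) (nonlin (U t))) (cmul f g)
      = tau (U t) (app (H t) f) (app Jop g) - tau (U t) f (app Jop (app (H t) g)) + pr (app (Jop * H t * H t * H t) f) g"
  proof -
    interpret t: bounded_bilinear "tau (U t)"
      by (rule bounded_bilinear_tau)
    have HJ: "hk (U t) (app Jop g) = - app Jop (hk (U t) g)"
      using arg_cong[OF Hop_Jop, of "\<lambda>A. app A g"] by (simp add: app.minus_left app_Hop)
    have "inner (cscale (- \<i>) (nonlin (U t))) (cmul f g) = inner (nonlin (U t)) (cmul f (app Jop g))"
      by (simp add: inner_cscale_left cmul_cscale)
    also have "\<dots> = tau (U t) (hk (U t) f) (app Jop g) - tau (U t) f (app Jop (hk (U t) g))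
        - pr (hk (U t) (hk (U t) f)) (hk (U t) (app Jop g))"
      unfolding nonlin_identity pr_hank by (simp only: HJ t.minus_right)
    also have "pr (hk (U t) (hk (U t) f)) (hk (U t) (app Jop g)) = pr (hk (U t) (hk (U t) (hk (U t) f))) (app Jop g)"
      by (metis app_Hop pr_Hop)
    also have "\<dots> = - pr (app (Jop * H t * H t * H t) f) g"
      using pr_Jop[of "hk (U t) (hk (U t) (hk (U t) f))" g] by (simp add: app_Hop del: app_Jop)
    finally show ?thesis
      by (simp add: app_Hop del: app_Jop)
  qed
  ultimately show "((\<lambda>s. pr (app (H s - H t) (F s)) (G s) / (s - t)) \<longlongrightarrow>
      tau (U t) (app (H t) f) (app Jop g) - tau (U t) f (app Jop (app (H t) g)) + pr (app (Jop * H t * H t * H t) f) g) (at t)"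
    by simp
qed

text \<open>\<open>H\<close> anticommutes with \<open>Jop\<close>, so the two cubic remainders
  cancel and a pure Lax equation is left.\<close>

lemma flow_HH: "flow (\<lambda>t. H t * H t) (\<lambda>t. 0)"
proof (rule flow_product[OF flow_H flow_H])
  fix t
  have "H t * (Jop * H t * H t * H t) = (H t * Jop) * (H t * H t * H t)"
    by (simp only: mult.assoc)
  also have "\<dots> = - (Jop * H t * H t * H t * H t)"
    unfolding Hop_Jop by (simp add: mult.assoc)
  finally show "0 = Jop * H t * H t * H t * H t + H t * (Jop * H t * H t * H t)"
    by simp
qed

text \<open>The part \<open>Lop * H^3\<close> of the remainder from \<open>Lop\<close> cancels the
  cubic remainder of \<open>H\<close>; the part with \<open>K * K * Lop\<close> becomes the cube of
  \<open>K\<close>.\<close>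

lemma flow_K: "flow K (\<lambda>t. Jop * K t * K t * K t)"
proof (rule flow_product[OF flow_L flow_H])
  fix t
  have "Lop * (Jop * H t * H t * H t) = Jop * (Lop * H t * H t * H t)"
    by (metis Lop_Jop mult.assoc)
  then show "Jop * K t * K t * K t = - (Jop * (Lop * (H t * H t) - K t * K t * Lop)) * H t + Lop * (Jop * H t * H t * H t)"
    by (simp add: algebra_simps)
qed

lemma Jop_K: "K t * Jop = - (Jop * K t)"
proof -
  have "K t * Jop = - (Lop * Jop * H t)"
    by (simp add: mult.assoc Hop_Jop)
  then show ?thesis
    by (simp add: Lop_Jop mult.assoc)
qed

lemma flow_KK: "flow (\<lambda>t. K t * K t) (\<lambda>t. 0)"
proof (rule flow_product[OF flow_K flow_K])
  fix t
  have "K t * (Jop * K t * K t * K t) = (K t * Jop) * (K t * K t * K t)"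
    by (simp only: mult.assoc)
  also have "\<dots> = - (Jop * K t * K t * K t * K t)"
    unfolding Jop_K by (simp add: mult.assoc)
  finally show "0 = Jop * K t * K t * K t * K t + K t * (Jop * K t * K t * K t)"
    by simp
qed

text \<open>Since \<open>u = H 1\<close>, the moment is \<open>(Q H 1 | 1)\<close>, with constants
  at both ends. There \<open>tau_single_0\<close> replaces \<open>T\<close> by the square of
  \<open>H\<close>, which removes the unbounded operator. The cubic remainder of \<open>H\<close>
  cancels the term from the right end of the word.\<close>

lemma flow_moment:
  assumes "flow Q R"
  shows "((\<lambda>s. cf (app (Q s) (emb (U s))) 0) has_vector_derivative
    cf (app (R t - Jop * (H t * H t) * Q t) (emb (U t))) 0) (at t)"
proof -
  let ?e = "single 0 1 :: quarter"
  obtain Qd where Q: "flow_with Q Qd R"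
    using assms by (auto simp: flow_def)
  obtain Hd where H: "flow_with H Hd (\<lambda>t. Jop * H t * H t * H t)"
    using flow_H by (auto simp: flow_def)
  have adj: "pr (app (Q t) f) g = pr f (app (Qd t) g)" "pr f (app (Hd t) g) = pr (app (H t) f) g" for t f g
    using Q H by (simp_all add: flow_with_def)
  define D where "D = app (R t - Jop * (H t * H t) * Q t) (emb (U t))"
  have "((\<lambda>s. pr (app (Q s) (emb (U s))) (single 0 d)) has_field_derivative pr D (single 0 d)) (at t)" for d
  proof -
    let ?g = "single 0 d :: quarter" and ?h = "hk (U t) :: quarter \<Rightarrow> quarter"
    have lim: "((\<lambda>s. pr (app (Q s * H s - Q t * H t) ?e) ?g / (s - t)) \<longlongrightarrow>
        tau (U t) (app (Q t * H t) ?e) (app Jop ?g) - tau (U t) ?e (app Jop (app (Hd t * Qd t) ?g))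
        + pr (app (R t * H t + Q t * (Jop * H t * H t * H t)) ?e) ?g) (at t)"
      using flow_mult[OF Q H] unfolding flow_with_def by (blast intro: tendsto_const)
    have J: "?h (app Jop x) = - app Jop (?h x)" for x
      using arg_cong[OF Hop_Jop, of "\<lambda>A. app A x"] by (simp add: app.minus_left app_Hop)
    have sym: "pr (?h x) y = pr x (?h y)" for x y
      by (metis app_Hop pr_Hop)
    have "tau (U t) (app (Q t * H t) ?e) (app Jop ?g) = - pr (app Jop (?h (?h (app (Q t) (emb (U t)))))) ?g"
    proof -
      have Jg: "app Jop ?g = single 0 (\<i> * d)"
        by (rule wl2_eqI) simp
      show ?thesis
        unfolding pr_Jop Jg tau_single_0 by (simp add: app_Hop hank_single_0_1)
    qed
    moreover have "tau (U t) ?e (app Jop (app (Hd t * Qd t) ?g)) = pr (app (Q t) (app Jop (?h (?h (emb (U t)))))) ?g"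
    proof -
      have "tau (U t) ?e (app Jop (app (Hd t * Qd t) ?g)) = pr (?h (?h (app Jop (app (Hd t) (app (Qd t) ?g))))) ?e"
        by (subst tau_commute) (simp add: tau_single_0 del: app_Jop)
      also have "\<dots> = pr (app Jop (app (Hd t) (app (Qd t) ?g))) (?h (?h ?e))"
        by (simp only: sym)
      also have "\<dots> = - pr (app Jop (?h (?h ?e))) (app (Hd t) (app (Qd t) ?g))"
        by (subst pr_Jop) (simp only: pr_commute)
      also have "\<dots> = - pr (app (Q t) (?h (app Jop (?h (?h ?e))))) ?g"
        by (simp add: adj app_Hop del: app_Jop)
      also have "\<dots> = pr (app (Q t) (app Jop (?h (?h (emb (U t)))))) ?g"
        unfolding J hank_single_0_1 by (simp add: app.minus_right pr.minus_left del: app_Jop)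
      finally show ?thesis .
    qed
    moreover have "pr (app (R t * H t + Q t * (Jop * H t * H t * H t)) ?e) ?g
        = pr (app (R t) (emb (U t))) ?g + pr (app (Q t) (app Jop (?h (?h (emb (U t)))))) ?g"
      by (simp add: app.add_left pr.add_left app_Hop hank_single_0_1 del: app_Jop)
    moreover have "pr D ?g = pr (app (R t) (emb (U t))) ?g - pr (app Jop (?h (?h (app (Q t) (emb (U t)))))) ?g"
      by (simp add: D_def app.diff_left pr.diff_left app_Hop del: app_Jop)
    moreover have "pr (app (Q s * H s - Q t * H t) ?e) ?g
        = pr (app (Q s) (emb (U s))) ?g - pr (app (Q t) (emb (U t))) ?g" for s
      by (simp add: app.diff_left pr.diff_left app_Hop hank_single_0_1)
    ultimately show ?thesis
      using lim unfolding has_field_derivative_iff by simp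
  qed
  then have d: "((\<lambda>s. pr (app (Q s) (emb (U s))) (single 0 d)) has_vector_derivative pr D (single 0 d)) (at t)" for d
    by (simp add: has_real_derivative_iff_has_vector_derivative)
  \<comment> \<open>Testing against 1 gives the real part and testing against \<i> the imaginary
    part.\<close>
  have c: "cf x 0 = of_real (pr x (single 0 1)) + \<i> * of_real (pr x (single 0 \<i>))" for x
    by (simp add: pr_single_0 complex_eq_iff)
  have bl: "bounded_linear (\<lambda>r. \<i> * of_real r :: complex)"
    by (intro bounded_linear_mult_right[THEN bounded_linear_compose] bounded_linear_of_real)
  show ?thesis
    unfolding c D_def[symmetric]
    by (intro has_vector_derivative_add bounded_linear.has_vector_derivative[OF bounded_linear_of_real]
        bounded_linear.has_vector_derivative[OF bl] d)
qed

end

section \<open>The hierarchy of moments\<close>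

text \<open>The letters stand for \<open>H_u^2\<close>, \<open>K_u^2\<close> and the adjoint
  shift.\<close>

datatype letter = LH | LK | LS

fun ev :: "'a::monoid_mult \<Rightarrow> 'a \<Rightarrow> 'a \<Rightarrow> letter list \<Rightarrow> 'a" where
  "ev h k l [] = 1"
| "ev h k l (LH # w) = h * ev h k l w"
| "ev h k l (LK # w) = k * ev h k l w"
| "ev h k l (LS # w) = l * ev h k l w"

text \<open>The formal derivation with \<open>h' = k' = 0\<close> and \<open>l' = l h - k l\<close>.\<close>
fun der :: "letter list \<Rightarrow> (real \<times> letter list) list" where
  "der [] = []"
| "der (LH # w) = map (apsnd (Cons LH)) (der w)"
| "der (LK # w) = map (apsnd (Cons LK)) (der w)"
| "der (LS # w) = (1, LS # LH # w) # (- 1, LK # LS # w) # map (apsnd (Cons LS)) (der w)"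

definition evs :: "'a::real_algebra_1 \<Rightarrow> 'a \<Rightarrow> 'a \<Rightarrow> (real \<times> letter list) list \<Rightarrow> 'a" where
  "evs h k l xs = (\<Sum>(c, v)\<leftarrow>xs. c *\<^sub>R ev h k l v)"

lemma evs_simps [simp]:
  "evs h k l [] = 0"
  "evs h k l ((c, v) # xs) = c *\<^sub>R ev h k l v + evs h k l xs"
  by (simp_all add: evs_def)

lemma evs_map_Cons [simp]:
  "evs h k l (map (apsnd (Cons LH)) xs) = h * evs h k l xs"
  "evs h k l (map (apsnd (Cons LK)) xs) = k * evs h k l xs"
  "evs h k l (map (apsnd (Cons LS)) xs) = l * evs h k l xs"
  by (induction xs; force simp: distrib_left)+

text \<open>These invariants feed the iteration in \<open>hierarchy_unique\<close>: unit
  coefficients, length growing by one, and a constant number of shift letters.\<close>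

lemma der_props:
  assumes "(c, v) \<in> set (der w)"
  shows "\<bar>c\<bar> = 1" "length v = Suc (length w)" "count_list v LS = count_list w LS"
  using assms by (induction w arbitrary: c v rule: der.induct) (auto simp: apsnd_def map_prod_def)

lemma length_der: "length (der w) = 2 * count_list w LS"
  by (induction w rule: der.induct) auto

lemma norm_ev_le:
  fixes h k l :: "'a::real_normed_algebra_1"
  assumes "norm h \<le> M" "norm k \<le> M" "norm l \<le> M"
  shows "norm (ev h k l w) \<le> M ^ length w"
proof -
  have M: "0 \<le> M"
    using norm_ge_zero[of h] assms(1) by linarith
  have *: "norm (x * y) \<le> M * M ^ n" if "norm x \<le> M" "norm y \<le> M ^ n" for x y :: 'a and n
    by (rule order_trans[OF norm_mult_ineq mult_mono]) (use that M in auto)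
  show ?thesis
    by (induction w rule: der.induct) (auto intro!: * assms)
qed

lemma ev_replicate: "ev h k l (replicate n LS) = l ^ n"
  by (induction n) auto

text \<open>With \<open>h\<close> and \<open>k\<close> constant, only the letter \<open>LS\<close>
  is differentiated. As \<open>J\<close> commutes with all letters it can be collected in front,
  leaving the formal derivation.\<close>

lemma ev_has_vector_derivative:
  fixes h k J :: "'a::real_normed_algebra_1"
  assumes l: "(l has_vector_derivative - (J * (l t * h - k * l t))) (at t)"
    and J: "J * h = h * J" "J * k = k * J" "J * l t = l t * J"
  shows "((\<lambda>t. ev h k (l t) w) has_vector_derivative - (J * evs h k (l t) (der w))) (at t)"
proof (induction w rule: der.induct)
  case 1
  show ?case by simp
next
  case (2 w)
  show ?case
    using has_vector_derivative_mult[OF has_vector_derivative_const[of h] 2] J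
    by simp (metis mult.assoc)
next
  case (3 w)
  show ?case
    using has_vector_derivative_mult[OF has_vector_derivative_const[of k] 3] J
    by simp (metis mult.assoc)
next
  case (4 w)
  have "l t * - (J * evs h k (l t) (der w)) + - (J * (l t * h - k * l t)) * ev h k (l t) w
      = - (J * evs h k (l t) (der (LS # w)))"
  proof -
    have "l t * (J * evs h k (l t) (der w)) = J * (l t * evs h k (l t) (der w))"
      by (metis J(3) mult.assoc)
    then show ?thesis
      by (simp add: algebra_simps)
  qed
  then show ?case
    using has_vector_derivative_mult[OF l 4] by simp
qed

text \<open>One integration of a power bound by the mean value inequality; negative times are
  reduced to positive ones by reflection.\<close>

lemma norm_integral_power_le:
  fixes f f' :: "real \<Rightarrow> 'a::real_normed_vector"
  assumes d: "\<And>s. (f has_vector_derivative f' s) (at s)" and 0: "f 0 = 0"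
    and b: "\<And>s. \<bar>s\<bar> \<le> T \<Longrightarrow> norm (f' s) \<le> A * \<bar>s\<bar> ^ k" and t: "\<bar>t\<bar> \<le> T"
  shows "norm (f t) \<le> A * \<bar>t\<bar> ^ Suc k / Suc k"
proof -
  have pos: "norm (g t) \<le> A * t ^ Suc k / Suc k"
    if d: "\<And>s. (g has_vector_derivative g' s) (at s)" and 0: "g 0 = 0"
    and b: "\<And>s. \<bar>s\<bar> \<le> T \<Longrightarrow> norm (g' s) \<le> A * \<bar>s\<bar> ^ k" and t: "0 < t" "t \<le> T"
    for g g' :: "real \<Rightarrow> 'a" and t
  proof -
    have "norm (g t - g 0) \<le> A * t ^ Suc k / Suc k - A * 0 ^ Suc k / Suc k"
    proof (rule differentiable_bound_general[OF t(1), where f' = g' and \<phi>' = "\<lambda>s. A * s ^ k"])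
      show "continuous_on {0..t} g"
        using d by (meson continuous_at_imp_continuous_on has_vector_derivative_continuous)
      show "continuous_on {0..t} (\<lambda>s. A * s ^ Suc k / Suc k)"
        by (intro continuous_intros) auto
      fix s assume s: "0 < s" "s < t"
      show "(g has_vector_derivative g' s) (at s)"
        by (rule d)
      show "((\<lambda>s. A * s ^ Suc k / Suc k) has_vector_derivative A * s ^ k) (at s)"
        unfolding has_real_derivative_iff_has_vector_derivative[symmetric]
        by (rule derivative_eq_intros refl | simp)+
      show "norm (g' s) \<le> A * s ^ k"
        using b[of s] s t by simp
    qed
    then show ?thesis
      by (simp add: 0)
  qed
  consider "t = 0" | "0 < t" | "t < 0"
    by linarith
  then show ?thesis
  proof cases
    case 1
    then show ?thesis by (simp add: 0)
  next
    case 2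
    then show ?thesis using pos[of f f' t] d 0 b t by simp
  next
    case 3
    have "((\<lambda>s. f (- s)) has_vector_derivative - f' (- s)) (at s)" for s
      using vector_diff_chain_at[OF has_vector_derivative_minus[OF has_vector_derivative_id] d, of s]
      by (simp add: o_def)
    moreover have "norm (- f' (- s)) \<le> A * \<bar>s\<bar> ^ k" if "\<bar>s\<bar> \<le> T" for s
      using b[of "- s"] that by simp
    ultimately show ?thesis
      using pos[of "\<lambda>s. f (- s)" "\<lambda>s. - f' (- s)" "- t"] 0 t 3 by simp
  qed
qed

text \<open>The additional word with \<open>LH\<close> in front comes from the evolution of the
  functional \<open>(\<cdot> | 1)\<close>; the others come from that of the word.\<close>

definition succs :: "letter list \<Rightarrow> (real \<times> letter list) list" where
  "succs w = (1, LH # w) # der w"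

lemma norm_sum_list_le:
  fixes f :: "'b \<Rightarrow> 'a::real_normed_vector"
  assumes "\<And>x. x \<in> set xs \<Longrightarrow> norm (f x) \<le> B"
  shows "norm (\<Sum>x\<leftarrow>xs. f x) \<le> real (length xs) * B"
  using assms
proof (induction xs)
  case (Cons x xs)
  then have "norm (f x + (\<Sum>x\<leftarrow>xs. f x)) \<le> B + real (length xs) * B"
    by (intro norm_triangle_mono) auto
  then show ?case
    by (simp add: algebra_simps)
qed simp

text \<open>Every step of the hierarchy lengthens the word by one but keeps the number \<open>n\<close> of letters
  \<open>LS\<close>, hence the number \<open>2 n + 1\<close> of terms; so the iterated bounds are those of an exponential series.\<close>
lemma hierarchy_unique:
  fixes \<delta> :: "letter list \<Rightarrow> real \<Rightarrow> complex"
  assumes d: "\<And>w t. (\<delta> w has_vector_derivative - \<i> * (\<Sum>(c, v)\<leftarrow>succs w. of_real c * \<delta> v t)) (at t)"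
    and 0: "\<And>w. \<delta> w 0 = 0"
    and bd: "\<And>w t. \<bar>t\<bar> \<le> T \<Longrightarrow> cmod (\<delta> w t) \<le> C * M ^ length w"
    and t: "\<bar>t\<bar> \<le> T"
  shows "\<delta> w t = 0"
proof -
  define n where "n = count_list w LS"
  define L where "L = real (2 * n + 1)"
  have iter: "cmod (\<delta> w t) \<le> C * M ^ (length w + k) * L ^ k / fact k * \<bar>t\<bar> ^ k"
    if "count_list w LS = n" "\<bar>t\<bar> \<le> T" for k w t
    using that
  proof (induction k arbitrary: w t)
    case 0
    then show ?case
      using bd by simp
  next
    case (Suc k)
    have "cmod (- \<i> * (\<Sum>(c, v)\<leftarrow>succs w. of_real c * \<delta> v s))
        \<le> L * (C * M ^ (length w + Suc k) * L ^ k / fact k) * \<bar>s\<bar> ^ k" if s: "\<bar>s\<bar> \<le> T" for s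
    proof -
      have "cmod (\<Sum>(c, v)\<leftarrow>succs w. of_real c * \<delta> v s)
          \<le> length (succs w) * (C * M ^ (length w + Suc k) * L ^ k / fact k * \<bar>s\<bar> ^ k)"
      proof (rule norm_sum_list_le)
        fix x assume "x \<in> set (succs w)"
        then obtain c v where x: "x = (c, v)" "\<bar>c\<bar> = 1" "length v = Suc (length w)" "count_list v LS = n"
        proof -
          obtain c v where x: "x = (c, v)"
            by fastforce
          then show thesis
            using Suc.prems(1) \<open>x \<in> set (succs w)\<close> der_props[of c v w] that[of c v]
            by (auto simp: succs_def)
        qed
        then show "cmod (case x of (c, v) \<Rightarrow> of_real c * \<delta> v s) \<le> C * M ^ (length w + Suc k) * L ^ k / fact k * \<bar>s\<bar> ^ k"
          using Suc.IH[of v s] s by (simp add: norm_mult)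
      qed
      also have "real (length (succs w)) = L"
        using Suc.prems(1) by (simp add: succs_def length_der L_def)
      finally show ?thesis
        by (simp add: norm_mult mult.assoc)
    qed
    then have "cmod (\<delta> w t) \<le> L * (C * M ^ (length w + Suc k) * L ^ k / fact k) * \<bar>t\<bar> ^ Suc k / Suc k"
      by (intro norm_integral_power_le[OF d 0 _ Suc.prems(2)])
    then show ?case
      by (simp add: field_simps)
  qed
  have "cmod (\<delta> w t) \<le> C * M ^ length w * (inverse (fact k) * (M * L * \<bar>t\<bar>) ^ k)" for k
    using iter[of w t k] t by (simp add: n_def power_add power_mult_distrib field_simps)
  moreover have "(\<lambda>k. C * M ^ length w * (inverse (fact k) * (M * L * \<bar>t\<bar>) ^ k)) \<longlonglongrightarrow> C * M ^ length w * 0"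
    by (intro tendsto_mult tendsto_const summable_LIMSEQ_zero summable_exp)
  ultimately have "cmod (\<delta> w t) \<le> 0"
    using LIMSEQ_le_const[of _ 0 "cmod (\<delta> w t)"] by auto
  then show ?thesis
    by simp
qed

section \<open>Exponentials of the Lax operators\<close>

lemma exp_commute:
  fixes A B :: "'a::{real_normed_algebra_1, banach}"
  assumes "A * B = B * A"
  shows "exp A * B = B * exp A"
proof -
  have "A ^ n * B = B * A ^ n" for n
    by (induction n) (simp_all, metis assms mult.assoc)
  then show ?thesis
    by (simp add: exp_def suminf_mult[symmetric] summable_exp_generic suminf_mult2)
qed


lemma continuous_on_imp_norm_bounded:
  fixes f :: "real \<Rightarrow> 'a::real_normed_vector"
  assumes "continuous_on UNIV f"
  shows "\<exists>M\<ge>0. \<forall>t. \<bar>t\<bar> \<le> T \<longrightarrow> norm (f t) \<le> M"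
proof -
  have "bounded (f ` {- T..T})"
    by (intro compact_imp_bounded compact_continuous_image continuous_on_subset[OF assms]) auto
  then obtain M where "0 < M" "\<And>y. y \<in> f ` {- T..T} \<Longrightarrow> norm y \<le> M"
    by (auto simp: bounded_pos)
  moreover have "f t \<in> f ` {- T..T}" if "\<bar>t\<bar> \<le> T" for t
    using that by (intro imageI) auto
  ultimately show ?thesis
    by (meson less_imp_le)
qed

text \<open>The weight is left free: moments are computed on \<open>quarter\<close>, where the weak
  Lax equations hold, whereas unitarity is used on L2.\<close>

definition propH :: "half \<Rightarrow> real \<Rightarrow> 'w::hankel_weight wl2 endo" where
  "propH a t = exp (t *\<^sub>R - (Jop * (Hop a * Hop a)))"

definition propK :: "half \<Rightarrow> real \<Rightarrow> 'w::hankel_weight wl2 endo" where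
  "propK a t = exp (t *\<^sub>R (Jop * ((Lop * Hop a) * (Lop * Hop a))))"

lemma mult_left_commute_ring:
  fixes J :: "'a::ring"
  assumes "J * h = h * J"
  shows "h * (J * x) = J * (h * x)"
  by (simp add: assms flip: mult.assoc)

lemma commute_mult:
  fixes J :: "'a::ring"
  assumes "J * a = a * J" "J * b = b * J"
  shows "J * (a * b) = (a * b) * J"
  by (metis assms mult.assoc)

lemma anticommute_square:
  fixes A J :: "'a::ring"
  assumes "A * J = - (J * A)"
  shows "J * (A * A) = (A * A) * J"
proof -
  have "(A * A) * J = A * (A * J)"
    by (rule mult.assoc)
  also have "\<dots> = A * - (J * A)"
    by (simp only: assms)
  also have "\<dots> = - ((A * J) * A)"
    by (simp add: mult.assoc)
  also have "\<dots> = - (- (J * A) * A)"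
    by (simp only: assms)
  also have "\<dots> = J * (A * A)"
    by (simp add: mult.assoc)
  finally show ?thesis ..
qed

lemma Jop_HH: "Jop * (Hop a * Hop a) = (Hop a * Hop a) * Jop"
  by (rule anticommute_square) (rule Hop_Jop)

lemma Lop_Hop_Jop: "(Lop * Hop a) * Jop = - (Jop * (Lop * Hop a))"
  by (simp add: mult.assoc Hop_Jop) (simp add: Lop_Jop flip: mult.assoc)

lemma Jop_KK: "Jop * ((Lop * Hop a) * (Lop * Hop a)) = ((Lop * Hop a) * (Lop * Hop a)) * Jop"
  by (rule anticommute_square) (rule Lop_Hop_Jop)

lemma propH_commute:
  assumes "(Jop * (Hop a * Hop a)) * B = B * (Jop * (Hop a * Hop a))"
  shows "propH a t * B = B * propH a t"
  unfolding propH_def by (rule exp_commute) (simp add: assms)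

lemma propK_commute:
  assumes "(Jop * ((Lop * Hop a) * (Lop * Hop a))) * B = B * (Jop * ((Lop * Hop a) * (Lop * Hop a)))"
  shows "propK a t * B = B * propK a t"
  unfolding propK_def by (rule exp_commute) (simp add: assms)

lemma propH_Jop: "Jop * propH a t = propH a t * Jop"
  by (rule propH_commute[symmetric]) (simp only: mult.assoc[of Jop] Jop_HH[symmetric])

lemma propK_Jop: "Jop * propK a t = propK a t * Jop"
  by (rule propK_commute[symmetric]) (simp only: mult.assoc[of Jop] Jop_KK[symmetric])

lemma cf_minus_Jop: "cf (app (- (Jop * A)) x) 0 = - \<i> * cf (app A x) 0"
  by (simp add: app.minus_left)

lemma cf_evs: "cf (app (evs h k l xs) x) 0 = (\<Sum>(c, v)\<leftarrow>xs. of_real c * cf (app (ev h k l v) x) 0)"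
  for x :: "'w::weight wl2"
  by (induction xs) (auto simp: app.zero_left app.add_left app.scaleR_left)

section \<open>The moments and their explicit model\<close>

context szego_curve
begin

text \<open>Induction with the product rule: the first two letters have no remainder, and the
  remainder of \<open>Lop\<close> is exactly the rule of \<open>der\<close> for
  \<open>LS\<close>.\<close>

lemma flow_word: "flow (\<lambda>t. ev (H t * H t) (K t * K t) Lop w) (\<lambda>t. - (Jop * evs (H t * H t) (K t * K t) Lop (der w)))"
proof (induction w rule: der.induct)
  case 1
  show ?case
    using flow_one by simp
next
  case (2 w)
  show ?case
    unfolding ev.simps by (rule flow_product[OF flow_HH 2]) (simp add: mult_left_commute_ring[OF Jop_HH])
next
  case (3 w)
  show ?case
    unfolding ev.simps by (rule flow_product[OF flow_KK 3]) (simp add: mult_left_commute_ring[OF Jop_KK])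
next
  case (4 w)
  show ?case
    unfolding ev.simps
  proof (rule flow_product[OF flow_L 4])
    fix t
    let ?h = "H t * H t" and ?k = "K t * K t"
    have "Lop * (Jop * evs ?h ?k Lop (der w)) = Jop * (Lop * evs ?h ?k Lop (der w))"
      by (rule mult_left_commute_ring) (rule Lop_Jop[symmetric])
    then show "- (Jop * evs ?h ?k Lop (der (LS # w)))
        = - (Jop * (Lop * ?h - ?k * Lop)) * ev ?h ?k Lop w + Lop * - (Jop * evs ?h ?k Lop (der w))"
      by (simp add: algebra_simps)
  qed
qed

definition moment :: "letter list \<Rightarrow> real \<Rightarrow> complex" where
  "moment w t = cf (app (ev (H t * H t) (K t * K t) Lop w) (emb (U t))) 0"

lemma moment_deriv:
  "(moment w has_vector_derivative - \<i> * (\<Sum>(c, v)\<leftarrow>succs w. of_real c * moment v t)) (at t)"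
proof -
  let ?h = "H t * H t" and ?k = "K t * K t"
  have "- (Jop * evs ?h ?k Lop (der w)) - Jop * ?h * ev ?h ?k Lop w = - (Jop * evs ?h ?k Lop (succs w))"
    by (simp add: succs_def algebra_simps)
  then have "cf (app (- (Jop * evs ?h ?k Lop (der w)) - Jop * ?h * ev ?h ?k Lop w) (emb (U t))) 0
      = - \<i> * (\<Sum>(c, v)\<leftarrow>succs w. of_real c * moment v t)"
    by (simp only: cf_minus_Jop cf_evs moment_def)
  then show ?thesis
    using flow_moment[OF flow_word[of w], of t] by (simp add: moment_def[abs_def])
qed

definition X :: "real \<Rightarrow> quarter endo" where
  "X t = propK (U 0) t * Lop * propH (U 0) t"

definition model :: "letter list \<Rightarrow> real \<Rightarrow> complex" where
  "model w t = cf (app (propH (U 0) t * ev (H 0 * H 0) (K 0 * K 0) (X t) w) (emb (U 0))) 0"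

lemma X_Jop: "Jop * X t = X t * Jop"
  unfolding X_def by (intro commute_mult propH_Jop propK_Jop Lop_Jop[symmetric])

lemma propH_deriv: "(propH (U 0) has_vector_derivative propH (U 0) t * - (Jop * (H 0 * H 0))) (at t)"
  unfolding propH_def[abs_def] by (rule exp_scaleR_has_vector_derivative_right)

text \<open>Because \<open>Jop\<close> commutes with \<open>X t\<close>, the two exponentials
  contribute precisely the formal rule of \<open>der\<close>, with the Lax operators frozen at time
  0.\<close>

lemma X_deriv: "(X has_vector_derivative - (Jop * (X t * (H 0 * H 0) - K 0 * K 0 * X t))) (at t)"
proof -
  have P: "(propK (U 0) has_vector_derivative (Jop * (K 0 * K 0)) * propK (U 0) t) (at t)"
    unfolding propK_def[abs_def] by (rule exp_scaleR_has_vector_derivative_left)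
  have "(X has_vector_derivative
      (propK (U 0) t * Lop) * (propH (U 0) t * - (Jop * (H 0 * H 0)))
      + (propK (U 0) t * 0 + (Jop * (K 0 * K 0)) * propK (U 0) t * Lop) * propH (U 0) t) (at t)"
    unfolding X_def[abs_def]
    by (intro has_vector_derivative_mult propH_deriv P has_vector_derivative_const)
  moreover have "(propK (U 0) t * Lop) * (propH (U 0) t * - (Jop * (H 0 * H 0)))
      + (propK (U 0) t * 0 + (Jop * (K 0 * K 0)) * propK (U 0) t * Lop) * propH (U 0) t
      = - (X t * Jop * (H 0 * H 0)) + Jop * (K 0 * K 0) * X t"
    by (simp add: X_def mult.assoc)
  moreover have "\<dots> = - (Jop * (X t * (H 0 * H 0) - K 0 * K 0 * X t))"
    unfolding X_Jop[symmetric] by (simp add: algebra_simps)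
  ultimately show ?thesis
    by simp
qed

text \<open>The propagator contributes the letter \<open>LH\<close> in front and the moving
  \<open>X t\<close> contributes \<open>der w\<close>, so the model solves the same hierarchy as the
  moments.\<close>

lemma model_deriv:
  "(model w has_vector_derivative - \<i> * (\<Sum>(c, v)\<leftarrow>succs w. of_real c * model v t)) (at t)"
proof -
  let ?h = "H 0 * H 0" and ?k = "K 0 * K 0" and ?E = "propH (U 0) :: real \<Rightarrow> quarter endo"
  define D where "D = evs ?h ?k (X t) (succs w)"
  have "((\<lambda>t. ev ?h ?k (X t) w) has_vector_derivative - (Jop * evs ?h ?k (X t) (der w))) (at t)"
    by (rule ev_has_vector_derivative[OF X_deriv Jop_HH Jop_KK X_Jop])
  from has_vector_derivative_mult[OF propH_deriv this]
  have "((\<lambda>t. ?E t * ev ?h ?k (X t) w) has_vector_derivative - (Jop * (?E t * D))) (at t)"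
  proof (rule has_vector_derivative_eq_rhs)
    have "Jop * (?E t * D) = ?E t * (Jop * D)"
      by (rule mult_left_commute_ring[symmetric]) (rule propH_Jop)
    then show "?E t * - (Jop * evs ?h ?k (X t) (der w)) + ?E t * - (Jop * (H 0 * H 0)) * ev ?h ?k (X t) w
        = - (Jop * (?E t * D))"
      by (simp add: D_def succs_def algebra_simps)
  qed
  then have "(model w has_vector_derivative cf (app (- (Jop * (?E t * D))) (emb (U 0))) 0) (at t)"
    unfolding model_def[abs_def]
    by (rule bounded_linear.has_vector_derivative[OF bounded_linear_compose[OF bounded_linear_cf app.bounded_linear_left]])
  moreover have "cf (app (?E t * D) (emb (U 0))) 0 = (\<Sum>(c, v)\<leftarrow>succs w. of_real c * model v t)"
  proof -
    have "cf (app (?E t * evs ?h ?k (X t) xs) x) 0 = (\<Sum>(c, v)\<leftarrow>xs. of_real c * cf (app (?E t * ev ?h ?k (X t) v) x) 0)" for xs x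
      by (induction xs) (auto simp: app.zero_left app.add_left app.scaleR_left app.zero_right app.add_right app.scaleR_right)
    then show ?thesis
      by (simp only: D_def model_def)
  qed
  ultimately show ?thesis
    by (simp only: cf_minus_Jop)
qed

text \<open>Norm continuity and compactness of the time interval bound all letters at once, so the
  bound is geometric in the length of the word.\<close>

lemma moment_bound: "\<exists>C M. 0 \<le> C \<and> 0 \<le> M \<and> (\<forall>w t. \<bar>t\<bar> \<le> T \<longrightarrow> cmod (moment w t) \<le> C * M ^ length w)"
proof -
  have U: "continuous_on UNIV U"
    using U_cont by (simp add: continuous_at_imp_continuous_on)
  then have H: "continuous_on UNIV H"
    by (rule bounded_linear.continuous_on[OF bounded_linear_Hop])
  obtain M1 where M1: "\<And>t. \<bar>t\<bar> \<le> T \<Longrightarrow> norm (H t * H t) \<le> M1"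
    using continuous_on_imp_norm_bounded[OF continuous_on_mult[OF H H], of T] by blast
  have K: "continuous_on UNIV K"
    by (intro continuous_on_mult continuous_on_const H)
  obtain M2 where M2: "\<And>t. \<bar>t\<bar> \<le> T \<Longrightarrow> norm (K t * K t) \<le> M2"
    using continuous_on_imp_norm_bounded[OF continuous_on_mult[OF K K], of T] by blast
  obtain C where C: "\<And>t. \<bar>t\<bar> \<le> T \<Longrightarrow> norm (emb (U t) :: quarter) \<le> C" "0 \<le> C"
    using continuous_on_imp_norm_bounded[OF bounded_linear.continuous_on[OF EHQ.bounded_linear_emb U], of T] by blast
  define M where "M = max M1 (max M2 (norm (Lop :: quarter endo)))"
  have M: "0 \<le> M"
    using norm_ge_zero[of "Lop :: quarter endo"] unfolding M_def by linarith
  have "cmod (moment w t) \<le> C * M ^ length w" if t: "\<bar>t\<bar> \<le> T" for w t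
  proof -
    have "norm (ev (H t * H t) (K t * K t) Lop w) \<le> M ^ length w"
      by (rule norm_ev_le) (use M1[OF t] M2[OF t] in \<open>auto simp: M_def\<close>)
    then have "norm (ev (H t * H t) (K t * K t) Lop w) * norm (emb (U t) :: quarter) \<le> M ^ length w * C"
      using C(1)[OF t] M by (intro mult_mono) auto
    then show ?thesis
      using norm_cf_le[of "app (ev (H t * H t) (K t * K t) Lop w) (emb (U t))" 0]
        norm_app_le[of "ev (H t * H t) (K t * K t) Lop w" "emb (U t)"]
      by (simp add: moment_def mult.commute)
  qed
  then show ?thesis
    using C(2) M by blast
qed

lemma model_bound: "\<exists>C M. 0 \<le> C \<and> 0 \<le> M \<and> (\<forall>w t. \<bar>t\<bar> \<le> T \<longrightarrow> cmod (model w t) \<le> C * M ^ length w)"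
proof -
  let ?h = "H 0 * H 0" and ?k = "K 0 * K 0"
  have "continuous_on UNIV X" "continuous_on UNIV (propH (U 0) :: real \<Rightarrow> quarter endo)"
    using has_vector_derivative_continuous[OF X_deriv] has_vector_derivative_continuous[OF propH_deriv]
    by (auto simp: continuous_at_imp_continuous_on)
  then obtain M1 C where b: "\<And>t. \<bar>t\<bar> \<le> T \<Longrightarrow> norm (X t) \<le> M1"
    "\<And>t. \<bar>t\<bar> \<le> T \<Longrightarrow> norm (propH (U 0) t :: quarter endo) \<le> C" "0 \<le> C"
    using continuous_on_imp_norm_bounded[of X T]
      continuous_on_imp_norm_bounded[of "propH (U 0) :: real \<Rightarrow> quarter endo" T] by blast
  define M where "M = max M1 (max (norm ?h) (norm ?k))"
  have M: "0 \<le> M"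
    using norm_ge_zero[of ?h] unfolding M_def by linarith
  let ?u = "emb (U 0) :: quarter"
  have "cmod (model w t) \<le> C * norm ?u * M ^ length w" if t: "\<bar>t\<bar> \<le> T" for w t
  proof -
    have "norm (ev ?h ?k (X t) w) \<le> M ^ length w"
      by (rule norm_ev_le) (use b(1)[OF t] in \<open>auto simp: M_def\<close>)
    then have "norm (propH (U 0) t :: quarter endo) * norm (ev ?h ?k (X t) w) \<le> C * M ^ length w"
      using b(2)[OF t] b(3) M by (intro mult_mono) auto
    then have "norm (propH (U 0) t * ev ?h ?k (X t) w) * norm ?u \<le> C * M ^ length w * norm ?u"
      by (intro mult_right_mono order_trans[OF norm_mult_ineq]) auto
    then show ?thesis
      using norm_cf_le[of "app (propH (U 0) t * ev ?h ?k (X t) w) ?u" 0]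
        norm_app_le[of "propH (U 0) t * ev ?h ?k (X t) w" ?u]
      by (simp add: model_def mult_ac del: app_mult)
  qed
  moreover have "0 \<le> C * norm ?u"
    using b(3) by simp
  ultimately show ?thesis
    using M by blast
qed

lemma moment_eq_model: "moment w t = model w t"
proof -
  obtain C1 M1 C2 M2 where b: "0 \<le> C1" "0 \<le> M1" "0 \<le> C2" "0 \<le> M2"
    "\<And>w s. \<bar>s\<bar> \<le> \<bar>t\<bar> \<Longrightarrow> cmod (moment w s) \<le> C1 * M1 ^ length w"
    "\<And>w s. \<bar>s\<bar> \<le> \<bar>t\<bar> \<Longrightarrow> cmod (model w s) \<le> C2 * M2 ^ length w"
    using moment_bound[of "\<bar>t\<bar>"] model_bound[of "\<bar>t\<bar>"] by blast
  have "moment w t - model w t = 0"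
  proof (rule hierarchy_unique[where \<delta> = "\<lambda>w t. moment w t - model w t" and T = "\<bar>t\<bar>" and C = "C1 + C2" and M = "max M1 M2"])
    fix w s
    have eq: "(\<Sum>(c, v)\<leftarrow>xs. of_real c * (moment v s - model v s))
        = (\<Sum>(c, v)\<leftarrow>xs. of_real c * moment v s) - (\<Sum>(c, v)\<leftarrow>xs. of_real c * model v s)" for xs
      by (induction xs) (auto simp: algebra_simps)
    show "((\<lambda>t. moment w t - model w t) has_vector_derivative
        - \<i> * (\<Sum>(c, v)\<leftarrow>succs w. of_real c * (moment v s - model v s))) (at s)"
      unfolding eq unfolding right_diff_distrib by (rule has_vector_derivative_diff[OF moment_deriv model_deriv])
    \<comment> \<open>At time 0 both exponentials are 1 and \<open>X 0\<close> is
      \<open>Lop\<close>.\<close>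
    show "moment w 0 - model w 0 = 0"
      by (simp add: moment_def model_def X_def propH_def propK_def)
    assume s: "\<bar>s\<bar> \<le> \<bar>t\<bar>"
    have "cmod (moment w s - model w s) \<le> C1 * M1 ^ length w + C2 * M2 ^ length w"
      using norm_triangle_ineq4[of "moment w s" "model w s"] b(5)[OF s, of w] b(6)[OF s, of w] by linarith
    also have "\<dots> \<le> C1 * max M1 M2 ^ length w + C2 * max M1 M2 ^ length w"
      using b(1-4) by (intro add_mono mult_left_mono power_mono) auto
    finally show "cmod (moment w s - model w s) \<le> (C1 + C2) * max M1 M2 ^ length w"
      by (simp add: distrib_right)
  qed simp
  then show ?thesis
    by simp
qed

text \<open>The moment of the \<open>n\<close>-th power of the adjoint shift is the
  \<open>n\<close>-th Fourier coefficient. Regrouping the model moves the propagator from the front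
  of the product to its end.\<close>

lemma explicit_quarter:
  "cf (U t) n = cf (app ((propH (U 0) t * propK (U 0) t * Lop) ^ n * propH (U 0) t) (emb (U 0) :: quarter)) 0"
proof -
  let ?E = "propH (U 0) t :: quarter endo" and ?P = "propK (U 0) t :: quarter endo"
  have "?E * X t ^ n = (?E * ?P * Lop) ^ n * ?E"
  proof (induction n)
    case (Suc n)
    have "?E * X t ^ Suc n = (?E * X t ^ n) * X t"
      by (simp add: power_Suc2 mult.assoc del: power_Suc)
    also have "\<dots> = (?E * ?P * Lop) ^ Suc n * ?E"
      unfolding Suc by (simp add: X_def power_Suc2 mult.assoc del: power_Suc)
    finally show ?case .
  qed simp
  moreover have "cf (U t) n = moment (replicate n LS) t"
    by (simp add: moment_def ev_replicate Lop_power EHQ.cf_emb)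
  moreover have "model (replicate n LS) t = cf (app (?E * X t ^ n) (emb (U 0))) 0"
    by (simp add: model_def ev_replicate)
  ultimately show ?thesis
    by (simp add: moment_eq_model del: app_mult)
qed

end

section \<open>Unitarity and the resolvent\<close>

text \<open>This links the exponential of the operator algebra to the coefficientwise series
  \<open>op_exp\<close>. Complex linearity of \<open>A\<close> lets the scalar be pulled out of the
  powers.\<close>

lemma cf_exp:
  fixes A C :: "'w::weight wl2 endo"
  assumes lin: "\<And>c x. app A (cscale c x) = cscale c (app A x)"
    and A: "\<And>x. cf (app A x) = As (cf x)"
    and C: "\<And>x. app C x = cscale c (app A x)"
  shows "cf (app (exp C) x) = op_exp As c (cf x)"
proof
  fix m
  have pA: "cf (app (A ^ n) x) = (As ^^ n) (cf x)" for n
    by (induction n) (auto simp: A)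
  have pC: "app (C ^ n) x = cscale (c ^ n) (app (A ^ n) x)" for n
    by (induction n) (auto intro!: wl2_eqI simp: C lin)
  have "bounded_linear (\<lambda>B. cf (app B x) m)"
    by (rule bounded_linear_compose[OF bounded_linear_cf app.bounded_linear_left])
  from bounded_linear.suminf[OF this summable_exp_generic[of C]]
  have "cf (app (exp C) x) m = (\<Sum>n. cf (app (C ^ n /\<^sub>R fact n) x) m)"
    by (simp add: exp_def)
  also have "\<dots> = (\<Sum>n. (c ^ n / of_nat (fact n)) * (As ^^ n) (cf x) m)"
    by (intro suminf_cong) (simp add: app.scaleR_left pC pA divide_inverse mult_ac)
  finally show "cf (app (exp C) x) m = op_exp As c (cf x) m"
    by (simp add: op_exp_def)
qed

lemma cscale_commute:
  assumes "A * Jop = Jop * A"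
  shows "app A (cscale c x) = cscale c (app A x)"
proof -
  have c: "cscale c y = Re c *\<^sub>R y + Im c *\<^sub>R app Jop y" for y :: "'a wl2"
    by (rule wl2_eqI) (simp add: complex_eq_iff)
  have "app A (app Jop x) = app Jop (app A x)"
    using arg_cong[OF assms, of "\<lambda>B. app B x"] by simp
  then show ?thesis
    unfolding c by (simp add: app.add_right app.scaleR_right del: app_Jop)
qed

lemma cf_HH: "cf (app (Hop a * Hop a) x) = hankel (cf a) (hankel (cf a) (cf x))"
  by (simp add: cf_Hop)

lemma cf_Lop_Hop: "cf (app (Lop * Hop a) x) = kop (cf a) (cf x)"
  by (simp add: Lop_Hop cf_Hop kop_def cf_Rop del: app_mult) (simp add: cf_Hop cf_Rop)

lemma cf_propH: "cf (app (propH a t) x) = op_exp (\<lambda>f. hankel (cf a) (hankel (cf a) f)) (- \<i> * of_real t) (cf x)"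
  unfolding propH_def
proof (rule cf_exp[of "Hop a * Hop a"])
  show "app (Hop a * Hop a) (cscale c x) = cscale c (app (Hop a * Hop a) x)" for c x
    by (rule cscale_commute[OF Jop_HH[symmetric]])
  show "app (t *\<^sub>R - (Jop * (Hop a * Hop a))) x = cscale (- \<i> * of_real t) (app (Hop a * Hop a) x)" for x
    by (rule wl2_eqI) (simp add: app.scaleR_left app.minus_left)
qed (rule cf_HH)

lemma cf_propK: "cf (app (propK a t) x) = op_exp (\<lambda>f. kop (cf a) (kop (cf a) f)) (\<i> * of_real t) (cf x)"
  unfolding propK_def
proof (rule cf_exp[of "(Lop * Hop a) * (Lop * Hop a)"])
  show "app ((Lop * Hop a) * (Lop * Hop a)) (cscale c x) = cscale c (app ((Lop * Hop a) * (Lop * Hop a)) x)" for c x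
    by (rule cscale_commute[OF Jop_KK[symmetric]])
  show "cf (app ((Lop * Hop a) * (Lop * Hop a)) x) = kop (cf a) (kop (cf a) (cf x))" for x
    by (simp only: app_mult[of "Lop * Hop a"] cf_Lop_Hop)
  show "app (t *\<^sub>R (Jop * ((Lop * Hop a) * (Lop * Hop a)))) x = cscale (\<i> * of_real t) (app ((Lop * Hop a) * (Lop * Hop a)) x)" for x
    by (rule wl2_eqI) (simp add: app.scaleR_left)
qed

section \<open>One step of the formula and its contractivity on L2\<close>

definition step :: "half \<Rightarrow> real \<Rightarrow> 'w::hankel_weight wl2 endo" where
  "step a t = propH a t * propK a t * Lop"

lemma cf_step:
  "cf (app (step a t) x) = op_exp (\<lambda>f. hankel (cf a) (hankel (cf a) f)) (- \<i> * of_real t)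
     (op_exp (\<lambda>f. kop (cf a) (kop (cf a) f)) (\<i> * of_real t) (shift_adj (cf x)))"
proof -
  have "cf (app Lop x) = shift_adj (cf x)"
    by (rule ext) (simp add: shift_adj_def)
  then show ?thesis
    by (simp add: step_def cf_propH cf_propK)
qed

text \<open>A step acts on coefficients by a formula that does not involve the weight, so results on
  \<open>quarter\<close> carry over to L2.\<close>

lemma cf_step_power_eq:
  fixes x :: "'u::hankel_weight wl2" and y :: "'w::hankel_weight wl2"
  assumes "cf x = cf y"
  shows "cf (app (step a t ^ n) x) = cf (app (step a t ^ n) y)"
  by (induction n) (simp_all add: assms cf_step)

lemma step_Jop: "step a t * Jop = Jop * step a t"
  unfolding step_def by (rule sym, intro commute_mult propH_Jop propK_Jop Lop_Jop[symmetric])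

text \<open>The product form behind \<open>pr_Hop\<close> is defined on \<open>quarter\<close> only,
  so on L2 symmetry is checked on monomials and extended by continuity.\<close>

lemma Hop_symmetric: "inner (app (Hop a) x) y = inner x (app (Hop a) y)" for x y :: ell2
proof (rule bounded_bilinear_ext_wl2[of "\<lambda>x y. inner (app (Hop a) x) y" "\<lambda>x y. inner x (app (Hop a) y)"])
  show "bounded_bilinear (\<lambda>x. inner (app (Hop a) x :: ell2))"
    by (rule bounded_bilinear.comp1[OF bounded_bilinear_inner app.bounded_linear_right])
  show "bounded_bilinear (\<lambda>x y :: ell2. inner x (app (Hop a) y))"
    by (rule bounded_bilinear.comp[OF bounded_bilinear_inner bounded_linear_ident app.bounded_linear_right])
  show "inner (app (Hop a) (single q c)) (single p d :: ell2) = inner (single q c) (app (Hop a) (single p d) :: ell2)" for q c p d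
    by (subst (2) inner_commute) (simp add: inner_ell2_single cf_Hop hankel_single add.commute algebra_simps)
qed

lemma Lop_Hop_symmetric: "inner (app (Lop * Hop a) x) y = inner x (app (Lop * Hop a) y)" for x y :: ell2
proof -
  have "inner (app (Lop * Hop a) x) y = inner x (app (Hop a * Rop) y)"
    by (simp add: Hop_symmetric flip: inner_Rop)
  then show ?thesis
    by (simp only: Lop_Hop)
qed

text \<open>Moving one factor \<open>A\<close> across the inner product and past \<open>Jop\<close>
  leaves \<open>(A x, Jop (A x))\<close>, which vanishes because \<open>Jop\<close> is skew.\<close>

lemma skew_square:
  fixes A :: "w_zero wl2 endo"
  assumes sym: "\<And>x y. inner (app A x) y = inner x (app A y)" and anti: "A * Jop = - (Jop * A)"
  shows "inner (app (Jop * (A * A)) x) x = 0"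
proof -
  have J: "inner (app Jop x) y = - inner x (app Jop y)" for x y :: ell2
  proof -
    have "inner (app Jop x) y = inner x (- app Jop y)"
      by (rule inner_ell2_ext) simp
    then show ?thesis
      by simp
  qed
  have "app A (app Jop x) = - app Jop (app A x)"
    using arg_cong[OF anti, of "\<lambda>B. app B x"] by (simp add: app.minus_left)
  then have "inner (app (Jop * (A * A)) x) x = inner (app A x) (app Jop (app A x))"
    by (simp add: J sym del: app_Jop)
  also have "\<dots> = 0"
    using J[of "app A x" "app A x"] inner_commute[of "app A x" "app Jop (app A x)"] by linarith
  finally show ?thesis .
qed

text \<open>The squared norm along the flow has derivative
  \<open>2 * inner (app C (e s)) (e s) = 0\<close>.\<close>

lemma exp_skew_isometry:
  fixes C :: "'a::{real_inner, banach, perfect_space} endo"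
  assumes "\<And>x. inner (app C x) x = 0"
  shows "norm (app (exp (t *\<^sub>R C)) x) = norm x"
proof -
  define e where "e s = app (exp (s *\<^sub>R C)) x" for s
  have e: "(e has_vector_derivative app C (e s)) (at s)" for s
    unfolding e_def[abs_def] app_mult[symmetric]
    by (rule bounded_linear.has_vector_derivative[OF app.bounded_linear_left exp_scaleR_has_vector_derivative_left])
  have "((\<lambda>s. inner (e s) (e s)) has_vector_derivative 0) (at s)" for s
    using bounded_bilinear.has_vector_derivative[OF bounded_bilinear_inner e e, of s] assms[of "e s"]
    by (simp add: inner_commute[of "e s"])
  then obtain c where "\<And>s. inner (e s) (e s) = c"
    using has_vector_derivative_zero_constant[of UNIV "\<lambda>s. inner (e s) (e s)"] by auto
  then have "inner (e t) (e t) = inner (e 0) (e 0)"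
    by simp
  then show ?thesis
    by (simp add: e_def norm_eq_sqrt_inner)
qed

lemma norm_step_le: "norm (app (step a t) x) \<le> norm x" for x :: ell2
proof -
  have H: "norm (app (propH a t) y) = norm y" for y :: ell2
    unfolding propH_def
    by (rule exp_skew_isometry) (simp add: app.minus_left skew_square[OF Hop_symmetric Hop_Jop] del: app_mult)
  have K: "norm (app (propK a t) y) = norm y" for y :: ell2
    unfolding propK_def
    by (rule exp_skew_isometry, rule skew_square[OF Lop_Hop_symmetric Lop_Hop_Jop])
  have "norm (app (step a t) x) = norm (app Lop x)"
    by (simp add: step_def H K)
  also have "\<dots> \<le> norm x"
  proof (rule power2_le_imp_le)
    \<comment> \<open>The adjoint shift is a contraction because its adjoint, the shift, is an
      isometry of L2.\<close>
    have "(norm (app Lop x))\<^sup>2 = inner (app Rop (app Lop x)) x"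
      by (simp add: power2_norm_eq_inner inner_Rop inner_commute[of _ x])
    also have "\<dots> \<le> norm (app Rop (app Lop x)) * norm x"
      by (rule norm_cauchy_schwarz)
    also have "norm (app Rop (app Lop x)) = norm (app Lop x)"
      by (simp add: norm_eq_sqrt_inner inner_Rop_Rop)
    finally have "norm (app Lop x) * norm (app Lop x) \<le> norm (app Lop x) * norm x"
      by (simp add: power2_eq_square)
    then show "(norm (app Lop x))\<^sup>2 \<le> (norm x)\<^sup>2"
      by (cases "norm (app Lop x) = 0") (auto intro!: power_mono)
  qed simp
  finally show ?thesis .
qed

text \<open>\<open>Z\<close> has norm at most \<open>cmod z < 1\<close>, so the Neumann series
  converges to a solution. Uniqueness, which the definite description in \<open>resolvent\<close>
  demands, follows since the difference of two solutions is fixed by \<open>Z\<close>.\<close>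

lemma resolvent_step:
  fixes w :: ell2
  assumes z: "cmod z < 1" and B: "\<And>x :: ell2. cf (app Y x) = B (cf x)"
    and J: "Y * Jop = Jop * Y" and contr: "\<And>x :: ell2. norm (app Y x) \<le> norm x"
  shows "l2_inner (resolvent z B (cf w)) one_seq = (\<Sum>n. cf (app (Y ^ n) w) 0 * z ^ n)"
proof -
  define Z where "Z = mk_endo (cscale z) * Y"
  have Z: "app Z x = cscale z (app Y x)" for x
    by (simp add: Z_def app_mk_endo bounded_linear_cscale)
  have Zle: "norm (app Z x) \<le> cmod z * norm x" for x
    unfolding Z norm_cscale by (intro mult_left_mono contr) simp
  have "norm Z \<le> cmod z"
    by (rule norm_endo_bound) (auto simp: Zle)
  then have summ: "summable (\<lambda>n. Z ^ n)"
    using z by (intro complete_algebra_summable_geometric) simp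
  define S where "S = (\<Sum>n. Z ^ n)"
  have "S = (\<Sum>n. Z ^ Suc n) + 1"
    unfolding S_def using suminf_split_initial_segment[OF summ, of 1] by simp
  also have "(\<Sum>n. Z ^ Suc n) = Z * S"
    unfolding S_def using suminf_mult[OF summ, of Z] by simp
  finally have S: "S = Z * S + 1" .
  define x where "x = app S w"
  have x: "x = app Z x + w"
    unfolding x_def using arg_cong[OF S, of "\<lambda>A. app A w"] by (simp add: app.add_left)
  have eq: "cf x n - z * B (cf x) n = cf w n" for n
  proof -
    have "cf x n = cf (app Z x + w) n"
      by (rule arg_cong[OF x])
    also have "\<dots> = cf w n + z * B (cf x) n"
      by (simp add: Z B)
    finally show ?thesis
      by (simp only: diff_eq_eq)
  qed
  have "resolvent z B (cf w) = cf x"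
    unfolding resolvent_def
  proof (rule the_equality)
    show "l2plus (cf x) \<and> (\<forall>n. cf x n - z * B (cf x) n = cf w n)"
      using eq summable_cf[of x] by (simp add: l2plus_def weight_simps)
    fix y assume y: "l2plus y \<and> (\<forall>n. y n - z * B y n = cf w n)"
    define y' :: ell2 where "y' = Abs_wl2 y"
    have cfy: "cf y' = y"
      unfolding y'_def using y by (intro cf_Abs) (simp add: l2plus_def weight_simps)
    have "y' = app Z y' + w"
    proof (rule wl2_eqI)
      fix n
      have "y n = cf w n + z * B y n"
        using y by (simp only: diff_eq_eq)
      also have "\<dots> = cf (app Z y' + w) n"
        by (simp add: Z B cfy)
      finally show "cf y' n = cf (app Z y' + w) n"
        by (simp only: cfy)
    qed
    then have "y' - x = (app Z y' + w) - (app Z x + w)"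
      using x by (rule arg_cong2)
    also have "\<dots> = app Z (y' - x)"
      by (simp add: app.diff_right)
    finally have "norm (y' - x) = norm (app Z (y' - x))"
      by (rule arg_cong)
    then have "norm (y' - x) \<le> cmod z * norm (y' - x)"
      using Zle[of "y' - x"] by linarith
    then have "norm (y' - x) * (1 - cmod z) \<le> 0"
      by (simp add: algebra_simps)
    then have "y' = x"
      using z by (simp add: mult_le_0_iff)
    then show "y = cf x"
      using cfy by simp
  qed
  \<comment> \<open>Pairing with the constant function 1 extracts the coefficient at 0.\<close>
  then have "l2_inner (resolvent z B (cf w)) one_seq = (\<Sum>k. if k = 0 then cf x k else 0)"
    unfolding l2_inner_def one_seq_def by (auto intro: suminf_cong)
  also have "\<dots> = cf x 0"
    by (rule sums_unique[symmetric, OF sums_single])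
  also have "\<dots> = (\<Sum>n. cf (app (Z ^ n) w) 0)"
    unfolding x_def S_def
    by (rule bounded_linear.suminf[OF bounded_linear_compose[OF bounded_linear_cf app.bounded_linear_left] summ])
  also have "\<dots> = (\<Sum>n. cf (app (Y ^ n) w) 0 * z ^ n)"
  proof -
    have "app (Z ^ n) w = cscale (z ^ n) (app (Y ^ n) w)" for n
      by (induction n) (auto intro!: wl2_eqI simp: Z cscale_commute[OF J])
    then show ?thesis
      by (simp add: mult.commute)
  qed
  finally show ?thesis .
qed

section \<open>Solutions as curves\<close>

text \<open>The equation is given coefficient by coefficient and has to be upgraded to a derivative
  in L2. The velocity \<open>v\<close> is continuous into L2, so its integral is differentiable
  there and differs from the curve by a constant.\<close>

lemma szego_curve_of_solution:
  assumes "szego_solution u u0"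
  defines "U \<equiv> \<lambda>t. Abs_wl2 (u t) :: half"
  shows "szego_curve U" and "\<And>t. cf (U t) = u t"
proof -
  have sol: "\<And>t. h12plus (u t)" "\<And>t. ((\<lambda>s. h12_norm (\<lambda>k. u s k - u t k)) \<longlongrightarrow> 0) (at t)"
    "\<And>t n. ((\<lambda>s. \<i> * u s n) has_vector_derivative szego_nl (u t) n) (at t)"
    using assms(1) unfolding szego_solution_def by blast+
  show cfU: "cf (U t) = u t" for t
    unfolding U_def using sol(1)[of t] by (intro cf_Abs) (simp add: h12plus_def weight_simps)
  have norm_diff: "norm (U s - U t) = h12_norm (\<lambda>k. u s k - u t k)" for s t
  proof -
    have "norm (U s - U t) = sqrt ((norm (U s - U t))\<^sup>2)"
      by simp
    also have "\<dots> = h12_norm (\<lambda>k. u s k - u t k)"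
      unfolding norm_wl2_sq by (simp add: h12_norm_def cfU weight_simps)
    finally show ?thesis .
  qed
  have cont: "isCont U t" for t
    unfolding isCont_def
    by (rule LIM_zero_cancel, rule tendsto_norm_zero_cancel) (simp add: norm_diff sol(2))
  define v where "v t = cscale (- \<i>) (nonlin (U t))" for t
  have "continuous_on UNIV U"
    using cont by (simp add: continuous_at_imp_continuous_on)
  then have U: "continuous_on A U" for A
    by (rule continuous_on_subset) simp
  have contv: "continuous_on A v" for A
    unfolding v_def[abs_def] nonlin_def
    by (intro bounded_linear.continuous_on[OF bounded_linear_cscale] HQbil.continuous_on CHbil.continuous_on
       bounded_linear.continuous_on[OF EHQ.bounded_linear_emb] U)
  show "szego_curve U"
  proof
    show "isCont U t" for t
      by (rule cont)
    fix t :: real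
    \<comment> \<open>The interval contains \<open>t\<close> in its interior, so the derivative
      within it is a full derivative at \<open>t\<close>.\<close>
    define a b where "a = t - 1" and "b = t + 1"
    define W where "W s = integral {a..s} v" for s
    have W: "(W has_vector_derivative v s) (at s within {a..b})" if "s \<in> {a..b}" for s
      unfolding W_def[abs_def] by (rule integral_has_vector_derivative[OF contv that])
    have un: "((\<lambda>s. cf (emb (U s) :: ell2) k) has_vector_derivative cf (v s) k) (at s within {a..b})" for s k
    proof -
      have "((\<lambda>s. - \<i> * (\<i> * u s k)) has_vector_derivative - \<i> * szego_nl (u s) k) (at s)"
        by (rule has_vector_derivative_mult_right[OF sol(3)])
      moreover have "- \<i> * (\<i> * u s k) = cf (emb (U s) :: ell2) k" for s
        by (simp add: EH0.cf_emb cfU)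
      moreover have "- \<i> * szego_nl (u s) k = cf (v s) k"
        by (simp add: v_def cf_nonlin cfU)
      ultimately show ?thesis
        by (simp only: has_vector_derivative_at_within)
    qed
    have tab: "t \<in> {a..b}"
      by (simp add: a_def b_def)
    \<comment> \<open>Each coefficient of the difference has derivative zero, and coefficients
      determine an element.\<close>
    have const: "emb (U s) - W s = emb (U t) - W t" if s: "s \<in> {a..b}" for s
    proof (rule wl2_eqI)
      fix k
      define f where "f s = cf (emb (U s) :: ell2) k - cf (W s) k" for s
      have "(f has_vector_derivative cf (v s) k - cf (v s) k) (at s within {a..b})" if "s \<in> {a..b}" for s
        unfolding f_def[abs_def]
        by (intro has_vector_derivative_diff un bounded_linear.has_vector_derivative[OF bounded_linear_cf] W that)
      then have f': "(f has_vector_derivative 0) (at s within {a..b})" if "s \<in> {a..b}" for s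
        using that by simp
      obtain c where c: "\<And>s. s \<in> {a..b} \<Longrightarrow> f s = c"
        using has_vector_derivative_zero_constant[OF convex_real_interval(5) f'] by blast
      have "f s = f t"
        by (simp only: c[OF s] c[OF tab])
      then show "cf (emb (U s) - W s) k = cf (emb (U t) - W t) k"
        by (simp only: f_def cf_diff)
    qed
    have eq: "(emb (U t) - W t) + W s = emb (U s)" if "s \<in> {a..b}" for s
      unfolding const[OF that, symmetric] by (rule diff_add_cancel)
    have "((\<lambda>s. (emb (U t) - W t) + W s) has_vector_derivative 0 + v t) (at t within {a..b})"
      by (intro has_vector_derivative_add has_vector_derivative_const W tab)
    then have "((\<lambda>s. emb (U s) :: ell2) has_vector_derivative 0 + v t) (at t within {a..b})"
      by (rule has_vector_derivative_transform[OF tab, rotated]) (rule eq[symmetric])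
    moreover have "at t within {a..b} = at t"
      by (rule at_within_interior) (simp add: a_def b_def)
    ultimately show "((\<lambda>s. emb (U s) :: ell2) has_vector_derivative cscale (- \<i>) (nonlin (U t))) (at t)"
      by (simp only: v_def add_0)
  qed
qed

theorem theorem1:
  fixes u0 :: seq and u :: "real \<Rightarrow> seq"
  assumes "h12plus u0"
    and "szego_solution u u0"
  shows "\<forall>t::real. \<forall>z::complex. cmod z < 1 \<longrightarrow>
    disc_ext (u t) z =
      l2_inner
        (resolvent z
           (\<lambda>h. op_exp (\<lambda>f. hankel u0 (hankel u0 f)) (- \<i> * of_real t)
                  (op_exp (\<lambda>f. kop u0 (kop u0 f)) (\<i> * of_real t) (shift_adj h)))
           (op_exp (\<lambda>f. hankel u0 (hankel u0 f)) (- \<i> * of_real t) u0))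
        one_seq"
proof (intro allI impI)
  fix t :: real and z :: complex
  assume z: "cmod z < 1"
  define U where "U t = (Abs_wl2 (u t) :: half)" for t
  have cfU: "cf (U t) = u t" for t
    unfolding U_def by (rule szego_curve_of_solution(2)[OF assms(2)])
  interpret szego_curve U
    unfolding U_def[abs_def] by (rule szego_curve_of_solution(1)[OF assms(2)])
  have u0: "u0 = cf (U 0)"
    using assms(2) by (simp add: cfU szego_solution_def)
  let ?Y = "step (U 0) t :: w_zero wl2 endo"
  define w :: ell2 where "w = app (propH (U 0) t) (emb (U 0))"
  have w: "cf w = op_exp (\<lambda>f. hankel u0 (hankel u0 f)) (- \<i> * of_real t) u0"
    by (simp add: w_def cf_propH EH0.cf_emb u0)
  \<comment> \<open>The coefficient formula was proved on \<open>quarter\<close>; it is transferred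
    to L2, where the step is a contraction and the resolvent is defined.\<close>
  have "u t n = cf (app (?Y ^ n) w) 0" for n
  proof -
    have "u t n = cf (app (step (U 0) t ^ n) (app (propH (U 0) t) (emb (U 0) :: quarter))) 0"
      using explicit_quarter[of t n] by (simp add: cfU step_def)
    also have "\<dots> = cf (app (?Y ^ n) w) 0"
      by (subst cf_step_power_eq[where y = w]) (simp_all add: w_def cf_propH EH0.cf_emb EHQ.cf_emb)
    finally show ?thesis .
  qed
  then have "disc_ext (u t) z = (\<Sum>n. cf (app (?Y ^ n) w) 0 * z ^ n)"
    by (simp add: disc_ext_def)
  also have "\<dots> = l2_inner (resolvent z
      (\<lambda>h. op_exp (\<lambda>f. hankel u0 (hankel u0 f)) (- \<i> * of_real t)
        (op_exp (\<lambda>f. kop u0 (kop u0 f)) (\<i> * of_real t) (shift_adj h))) (cf w)) one_seq"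
    by (rule resolvent_step[symmetric, OF z _ step_Jop norm_step_le]) (simp add: cf_step u0)
  finally show "disc_ext (u t) z =
      l2_inner
        (resolvent z
           (\<lambda>h. op_exp (\<lambda>f. hankel u0 (hankel u0 f)) (- \<i> * of_real t)
                  (op_exp (\<lambda>f. kop u0 (kop u0 f)) (\<i> * of_real t) (shift_adj h)))
           (op_exp (\<lambda>f. hankel u0 (hankel u0 f)) (- \<i> * of_real t) u0))
        one_seq"
    by (simp only: w)
qed

end
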